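(* Let $d \ge 4$ be an integer and let $c_\mu>0$. There exists a number $s_0=s_0(d,c_\mu)<d$, depending only on $d$ and $c_\mu$, such that the following holds. Let $E\subset\mathbb{R}^d$ be compact, and let $\mu$ be a Borel probability measure supported on $E$ which satisfies, for some $s>s_0$, $$\mu(B(x,r))\le c_\mu\, r^s\quad\text{for all } x\in\mathbb{R}^d,\ r>0.$$ Then $E$ contains the vertices of an equilateral triangle.
   Context: $B(x,r)$ denotes the Euclidean ball of center $x$ and radius $r$. "$E$ contains the vertices of an equilateral triangle" means that there are points $x,y,z\in E$ with $|x-y|=|y-z|=|x-z|>0$ (so the triangle is non-degenerate), where $|\cdot|$ is the Euclidean norm. *)

theory Defs
  imports "HOL-Probability.Probability"
begin

definition contains_equilateral_triangle :: "(real ^ 'n) set \<Rightarrow> bool" where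
  "contains_equilateral_triangle E \<longleftrightarrow>
     (\<exists>x\<in>E. \<exists>y\<in>E. \<exists>z\<in>E.
        norm (x - y) = norm (y - z) \<and> norm (y - z) = norm (x - z) \<and> norm (x - z) > 0)"

text \<open>For a closed set \<open>E\<close>, vanishing outside \<open>E\<close> is the same as having topological support
  contained in \<open>E\<close>.\<close>

definition borel_prob_measure_supported_on ::
    "(real ^ 'n) measure \<Rightarrow> (real ^ 'n) set \<Rightarrow> bool" where
  "borel_prob_measure_supported_on \<mu> E \<longleftrightarrow>
     prob_space \<mu> \<and> sets \<mu> = sets borel \<and> emeasure \<mu> (- E) = 0"

end

theory Submission
  imports Defs
begin

text \<open>
  The theorem is proved by counting triangles with a weight. For densities \<open>f\<close>, \<open>g\<close>, \<open>h\<close> on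
  \<open>d\<close>-dimensional space, \<open>triangle_form\<close> integrates \<open>f x * g y * h z\<close> over random triangles \<open>x, y, z\<close> that
  are equilateral up to a relative error \<open>\<epsilon>\<close>. If the form is positive for \<open>f = g = h\<close> the average of the
  given measure over small balls, then three points near \<open>E\<close> form a nearly equilateral triangle, with sides
  bounded below; letting the radius of the balls and \<open>\<epsilon>\<close> tend to \<open>0\<close>, compactness gives a triangle in \<open>E\<close>.

  Positivity comes from comparing scales. Among all balls, take one that nearly maximises
  \<open>measure \<mu> (ball a \<rho>) / \<rho> powr s\<close>, and rescale it to the unit ball
  (\<open>exists_nearly_extremal_ball\<close>, \<open>blow_up_ball\<close>). The resulting probability measure satisfies the growth
  condition with the constant \<open>1 + \<eta>\<close>, whatever the original constant was. If \<open>s\<close> is close to \<open>d\<close>, its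
  average at a fixed scale \<open>1 / 16 ^ n\<close> is then a density that is almost the constant
  \<open>1 / measure lborel (ball 0 1)\<close> on the unit ball, since there is no room for anything else, and for it the
  form is bounded below by a constant depending on \<open>d\<close> (\<open>triangle_form_pos_coarse_scale\<close>).

  It remains to bound the loss in the form when the scale is refined from \<open>1 / 16 ^ j\<close> to
  \<open>1 / 16 ^ Suc j\<close>, for all \<open>j \<ge> n\<close> (\<open>triangle_form_coarsening\<close>). The densities are bounded by a constant
  times \<open>q ^ j\<close>, where \<open>q\<close> is close to \<open>1\<close>, so it suffices that the form is small by a fixed power of
  \<open>1 / 16 ^ j\<close> whenever one argument is the difference \<open>D\<close> of a bounded density and its average at this
  scale (\<open>triangle_form_smoothing_error\<close>). Fix the two other vertices. In dimension at least three, the third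
  one still moves on a sphere about the opposite side, and \<open>D\<close> may be averaged over many positions on this
  sphere. The inequality between the arithmetic and the geometric mean then separates the other two densities
  from this average, and there remains the correlation of \<open>D\<close> with itself at two positions \<open>z\<close>, \<open>z'\<close>. Averaged over rotations and side lengths, \<open>z - z'\<close> is
  \<open>norm (w - w')\<close> times a vector with a density in the whole space, where \<open>w\<close>, \<open>w'\<close> are the positions of
  \<open>z\<close>, \<open>z'\<close> in a reference triangle; integration against such a density makes \<open>D\<close> small
  (\<open>random_arm_smooths\<close>), unless \<open>w = w'\<close>, which happens for few of the pairs.

  The rotations are taken from a thin neighbourhood of the orthogonal group in the space of matrices with
  Lebesgue measure. All that matters is the invariance of their law under right multiplication by
  orthogonal matrices (\<open>random_near_isometry_invariant\<close>).
\<close>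

section \<open>Isometries and shears preserve Lebesgue measure\<close>

lemma nn_integral_lborel_shift:
  fixes c :: "'a::euclidean_space"
  assumes [measurable]: "f \<in> borel_measurable borel"
  shows "(\<integral>\<^sup>+x. f (x + c) \<partial>lborel) = (\<integral>\<^sup>+x. f x \<partial>lborel)"
proof -
  have "(\<integral>\<^sup>+x. f x \<partial>lborel) = (\<integral>\<^sup>+x. f x \<partial>distr lborel borel ((+) c))"
    by (simp add: lborel_distr_plus)
  also have "\<dots> = (\<integral>\<^sup>+x. f (c + x) \<partial>lborel)"
    by (subst nn_integral_distr) auto
  finally show ?thesis by (simp add: add.commute)
qed

text \<open>
  A translation-invariant measure is determined by its value on one ball: integrating
  \<open>indicator A (T x) * indicator B (y - T x)\<close> over \<open>x\<close> and \<open>y\<close> in both orders gives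
  \<open>\<nu> A * \<lambda> B = \<lambda> A * \<nu> (- B)\<close>, where \<open>\<nu>\<close> is the image of \<open>\<lambda>\<close> under \<open>T\<close>. For the unit ball \<open>B\<close>,
  which \<open>T\<close> preserves, this says \<open>\<nu> = \<lambda>\<close>. The lemma is applied to the space of matrices.
\<close>

lemma lborel_distr_linear_isometry:
  fixes T :: "'a::euclidean_space \<Rightarrow> 'a"
  assumes lin: "linear T" and iso: "\<And>x. norm (T x) = norm x"
  shows "distr lborel borel T = lborel"
proof (rule measure_eqI)
  have [measurable]: "T \<in> borel_measurable borel"
    using lin by (intro borel_measurable_continuous_onI linear_continuous_on) (simp add: linear_conv_bounded_linear)
  have "inj T"
    using iso lin by (metis linear_injective_0 norm_eq_zero)
  then have "surj T"
    using lin linear_injective_imp_surjective by blast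
  fix A :: "'a set" assume "A \<in> sets (distr lborel borel T)"
  then have [measurable]: "A \<in> sets borel" by simp
  let ?B = "ball (0::'a) 1"
  let ?I = "\<lambda>x y. indicator A (T x) * indicator ?B (y - T x) :: ennreal"
  have [measurable]: "?B \<in> sets borel" by simp
  have "0 < measure lborel ?B" by (rule content_ball_pos) simp
  then have Bpos: "emeasure lborel ?B \<noteq> 0" by (auto simp: measure_def)
  have B: "(\<integral>\<^sup>+y. indicator ?B (y - z) \<partial>lborel) = emeasure lborel ?B" for z :: 'a
    using nn_integral_lborel_shift[of "indicator ?B :: 'a \<Rightarrow> ennreal" "-z"] by (simp add: borel_measurable_indicator)
  have A: "(\<integral>\<^sup>+y. indicator A (z + y) \<partial>lborel) = emeasure lborel A" for z :: 'a
    using nn_integral_lborel_shift[of "indicator A :: 'a \<Rightarrow> ennreal" "z"] by (simp add: add.commute)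
  have sh: "(\<integral>\<^sup>+x. ?I x y \<partial>lborel) = (\<integral>\<^sup>+x. indicator A (T x + y) * indicator ?B x \<partial>lborel)" for y
  proof -
    obtain c where c: "T c = y" using \<open>surj T\<close> by (metis surjD)
    have "(\<integral>\<^sup>+x. ?I x y \<partial>lborel) = (\<integral>\<^sup>+x. ?I (x + c) y \<partial>lborel)"
      by (rule nn_integral_lborel_shift[symmetric]) measurable
    also have "\<dots> = (\<integral>\<^sup>+x. indicator A (T x + y) * indicator ?B x \<partial>lborel)"
      using iso by (intro nn_integral_cong) (auto simp: linear_add[OF lin] c split: split_indicator)
    finally show ?thesis .
  qed
  have "emeasure (distr lborel borel T) A * emeasure lborel ?B
      = (\<integral>\<^sup>+x. indicator A (T x) \<partial>lborel) * emeasure lborel ?B"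
    using nn_integral_distr[of T lborel borel "indicator A"] by simp
  also have "\<dots> = (\<integral>\<^sup>+x. \<integral>\<^sup>+y. ?I x y \<partial>lborel \<partial>lborel)"
    by (simp add: nn_integral_cmult nn_integral_multc B)
  also have "\<dots> = (\<integral>\<^sup>+y. \<integral>\<^sup>+x. ?I x y \<partial>lborel \<partial>lborel)"
    by (rule lborel_pair.Fubini') measurable
  also have "\<dots> = (\<integral>\<^sup>+y. \<integral>\<^sup>+x. indicator A (T x + y) * indicator ?B x \<partial>lborel \<partial>lborel)"
    by (simp add: sh)
  also have "\<dots> = (\<integral>\<^sup>+x. \<integral>\<^sup>+y. indicator A (T x + y) * indicator ?B x \<partial>lborel \<partial>lborel)"
    by (rule lborel_pair.Fubini') measurable
  also have "\<dots> = emeasure lborel A * emeasure lborel ?B"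
    by (simp add: nn_integral_cmult nn_integral_multc A)
  finally show "emeasure (distr lborel borel T) A = emeasure lborel A"
    using emeasure_lborel_ball_finite[of "0::'a" 1] Bpos
    by (subst (asm) (1 2) mult.commute, subst (asm) ennreal_mult_cancel_left) auto
qed simp

lemma nn_integral_shear:
  fixes c :: "'b \<Rightarrow> 'a::euclidean_space"
  assumes P: "sigma_finite_measure P" and [measurable]: "c \<in> borel_measurable P"
    and [measurable]: "F \<in> borel_measurable (lborel \<Otimes>\<^sub>M P)"
  shows "(\<integral>\<^sup>+z. F (fst z + c (snd z), snd z) \<partial>(lborel \<Otimes>\<^sub>M P)) = (\<integral>\<^sup>+z. F z \<partial>(lborel \<Otimes>\<^sub>M P))"
proof -
  interpret pair_sigma_finite lborel P
    using P by (simp add: pair_sigma_finite_def sigma_finite_lborel)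
  have "(\<integral>\<^sup>+z. F (fst z + c (snd z), snd z) \<partial>(lborel \<Otimes>\<^sub>M P)) = (\<integral>\<^sup>+\<omega>. \<integral>\<^sup>+x. F (x + c \<omega>, \<omega>) \<partial>lborel \<partial>P)"
    by (subst nn_integral_snd[symmetric]) (auto simp: split_beta)
  also have "\<dots> = (\<integral>\<^sup>+\<omega>. \<integral>\<^sup>+x. F (x, \<omega>) \<partial>lborel \<partial>P)"
    by (intro nn_integral_cong nn_integral_lborel_shift) measurable
  also have "\<dots> = (\<integral>\<^sup>+z. F z \<partial>(lborel \<Otimes>\<^sub>M P))"
    by (subst nn_integral_snd[symmetric]) auto
  finally show ?thesis .
qed

text \<open>
  This is the change of base point in a random configuration: \<open>\<omega>\<close> determines the shape of
  the configuration, \<open>x\<close> one of its points, and \<open>x + c \<omega>\<close> another.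
\<close>

lemma distr_shear:
  fixes c :: "'b \<Rightarrow> 'a::euclidean_space"
  assumes P: "sigma_finite_measure P" and [measurable]: "c \<in> borel_measurable P"
  shows "distr (lborel \<Otimes>\<^sub>M P) (lborel \<Otimes>\<^sub>M P) (\<lambda>(x,\<omega>). (x + c \<omega>, \<omega>)) = lborel \<Otimes>\<^sub>M P"
    (is "distr ?Q ?Q ?T = ?Q")
proof (rule measure_eqI)
  fix A assume "A \<in> sets (distr ?Q ?Q ?T)"
  then have [measurable]: "A \<in> sets ?Q" by simp
  have [measurable]: "?T \<in> measurable ?Q ?Q" by measurable
  have "emeasure (distr ?Q ?Q ?T) A = (\<integral>\<^sup>+z. indicator A z \<partial>distr ?Q ?Q ?T)"
    using \<open>A \<in> sets ?Q\<close> by simp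
  also have "\<dots> = (\<integral>\<^sup>+z. indicator A (?T z) \<partial>?Q)"
    by (rule nn_integral_distr) auto
  also have "\<dots> = emeasure ?Q A"
    using nn_integral_shear[OF assms, of "indicator A"] \<open>A \<in> sets ?Q\<close> by (simp add: split_beta)
  finally show "emeasure (distr ?Q ?Q ?T) A = emeasure ?Q A" .
qed simp

lemma
  fixes c :: "'b \<Rightarrow> 'a::euclidean_space" and F :: "'a \<times> 'b \<Rightarrow> real"
  assumes P: "sigma_finite_measure P" and [measurable]: "c \<in> borel_measurable P"
    and [measurable]: "F \<in> borel_measurable (lborel \<Otimes>\<^sub>M P)"
  shows integral_shear:
      "(\<integral>z. F (fst z + c (snd z), snd z) \<partial>(lborel \<Otimes>\<^sub>M P)) = (\<integral>z. F z \<partial>(lborel \<Otimes>\<^sub>M P))"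
    and integrable_shear:
      "integrable (lborel \<Otimes>\<^sub>M P) (\<lambda>z. F (fst z + c (snd z), snd z)) \<longleftrightarrow> integrable (lborel \<Otimes>\<^sub>M P) F"
proof -
  let ?Q = "lborel \<Otimes>\<^sub>M P" and ?T = "\<lambda>(x,\<omega>). (x + c \<omega>, \<omega>)"
  have [measurable]: "?T \<in> measurable ?Q ?Q" by measurable
  show "(\<integral>z. F (fst z + c (snd z), snd z) \<partial>?Q) = (\<integral>z. F z \<partial>?Q)"
    using integral_distr[of ?T ?Q ?Q F] by (simp add: distr_shear[OF assms(1,2)] split_beta)
  show "integrable ?Q (\<lambda>z. F (fst z + c (snd z), snd z)) \<longleftrightarrow> integrable ?Q F"
    using integrable_distr_eq[of ?T ?Q ?Q F] by (simp add: distr_shear[OF assms(1,2)] split_beta)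
qed

lemma (in prob_space) integrable_lborel_pair_fst:
  fixes h :: "'b::euclidean_space \<Rightarrow> real"
  assumes h: "integrable lborel h"
  shows "integrable (lborel \<Otimes>\<^sub>M M) (\<lambda>z. h (fst z))"
    and "(\<integral>z. h (fst z) \<partial>(lborel \<Otimes>\<^sub>M M)) = (\<integral>x. h x \<partial>lborel)"
proof -
  interpret Q: pair_sigma_finite lborel M
    by (simp add: pair_sigma_finite_def sigma_finite_lborel sigma_finite_measure_axioms)
  have [measurable]: "h \<in> borel_measurable borel" using h by auto
  show *: "integrable (lborel \<Otimes>\<^sub>M M) (\<lambda>z. h (fst z))"
    using h by (intro Q.Fubini_integrable) (auto simp: prob_space)
  show "(\<integral>z. h (fst z) \<partial>(lborel \<Otimes>\<^sub>M M)) = (\<integral>x. h x \<partial>lborel)"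
    using Q.integral_fst'[OF *] by (simp add: prob_space)
qed

section \<open>Random near-isometries\<close>

text \<open>
  A thickening of the orthogonal group. For \<open>\<epsilon> > 0\<close> it has positive finite Lebesgue measure, which is
  invariant under right multiplication by orthogonal matrices, so it serves instead of a Haar measure on
  the group itself; the price is that triangles become equilateral only up to \<open>\<epsilon>\<close>.
\<close>

definition near_isometries :: "real \<Rightarrow> (real^'n^'n) set" where
  "near_isometries \<epsilon> = {A. \<forall>w. (1 - \<epsilon>) * norm w \<le> norm (A *v w) \<and> norm (A *v w) \<le> (1 + \<epsilon>) * norm w}"

lemma near_isometriesD:
  "A \<in> near_isometries \<epsilon> \<Longrightarrow> (1 - \<epsilon>) * norm w \<le> norm (A *v w)"
  "A \<in> near_isometries \<epsilon> \<Longrightarrow> norm (A *v w) \<le> (1 + \<epsilon>) * norm w"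
  by (auto simp: near_isometries_def)

lemma continuous_on_matrix_apply [continuous_intros]:
  fixes f :: "'a::topological_space \<Rightarrow> real^'n^'n" and g :: "'a \<Rightarrow> real^'n"
  assumes "continuous_on S f" "continuous_on S g"
  shows "continuous_on S (\<lambda>x. f x *v g x)"
  unfolding matrix_vector_mult_def
  by (intro continuous_intros assms)

text \<open>
  The norm of a matrix is the Euclidean norm of the vector of its entries, so this is
  Cauchy--Schwarz row by row.
\<close>

lemma norm_matrix_apply_le: "norm ((A::real^'n^'n) *v w) \<le> norm A * norm w"
proof -
  have "norm (A *v w) = L2_set (\<lambda>i. \<bar>A $ i \<bullet> w\<bar>) UNIV"
    by (simp add: norm_vec_def matrix_vector_mul_component)
  also have "\<dots> \<le> L2_set (\<lambda>i. norm (A $ i) * norm w) UNIV"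
    by (intro L2_set_mono) (auto intro: Cauchy_Schwarz_ineq2)
  also have "\<dots> = norm A * norm w"
    by (simp add: L2_set_left_distrib norm_vec_def)
  finally show ?thesis .
qed

lemma closed_near_isometries: "closed (near_isometries \<epsilon>)"
  unfolding near_isometries_def
  by (intro closed_Collect_all closed_Collect_conj closed_Collect_le continuous_intros)

lemma near_isometries_borel [measurable]: "near_isometries \<epsilon> \<in> sets borel"
  by (rule borel_closed[OF closed_near_isometries])

lemma bounded_near_isometries: "bounded (near_isometries \<epsilon> :: (real^'n^'n) set)"
proof (rule boundedI)
  fix A :: "real^'n^'n" assume A: "A \<in> near_isometries \<epsilon>"
  have comp: "\<bar>A $ i $ j\<bar> \<le> 1 + \<epsilon>" for i j
  proof -
    have "\<bar>A $ i $ j\<bar> = \<bar>(A *v axis j 1) $ i\<bar>"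
      by (simp add: matrix_vector_mult_basis column_def)
    also have "\<dots> \<le> norm (A *v axis j 1)"
      by (rule component_le_norm_cart)
    also have "\<dots> \<le> 1 + \<epsilon>"
      using near_isometriesD(2)[OF A, of "axis j 1"] by simp
    finally show ?thesis .
  qed
  have "norm A \<le> (\<Sum>i\<in>UNIV. norm (A $ i))"
    unfolding norm_vec_def[of A] by (rule L2_set_le_sum) simp
  also have "\<dots> \<le> (\<Sum>i\<in>(UNIV::'n set). \<Sum>j\<in>UNIV. \<bar>A $ i $ j\<bar>)"
    by (intro sum_mono norm_le_l1_cart)
  also have "\<dots> \<le> (\<Sum>i\<in>(UNIV::'n set). \<Sum>j\<in>(UNIV::'n set). 1 + \<epsilon>)"
    by (intro sum_mono comp)
  finally show "norm A \<le> (\<Sum>i\<in>(UNIV::'n set). \<Sum>j\<in>(UNIV::'n set). 1 + \<epsilon>)" .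
qed

lemma ball_subset_near_isometries: "ball (mat 1) \<epsilon> \<subseteq> near_isometries \<epsilon>"
proof
  fix A :: "real^'n^'n" assume "A \<in> ball (mat 1) \<epsilon>"
  then have e: "norm (A - mat 1) \<le> \<epsilon>" by (simp add: dist_norm norm_minus_commute)
  have "norm (A *v w - w) \<le> \<epsilon> * norm w" for w
  proof -
    have "norm (A *v w - w) = norm ((A - mat 1) *v w)"
      by (simp add: matrix_vector_mult_diff_rdistrib)
    also have "\<dots> \<le> \<epsilon> * norm w"
      using norm_matrix_apply_le[of "A - mat 1" w] mult_right_mono[OF e, of "norm w"] by simp
    finally show ?thesis .
  qed
  then have "\<bar>norm (A *v w) - norm w\<bar> \<le> \<epsilon> * norm w" for w
    using norm_triangle_ineq3[of "A *v w" w] by (rule order_trans[rotated])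
  then show "A \<in> near_isometries \<epsilon>"
    unfolding near_isometries_def by (auto simp: algebra_simps abs_le_iff)
qed

lemma emeasure_near_isometries:
  assumes "\<epsilon> > 0"
  shows "emeasure lborel (near_isometries \<epsilon> :: (real^'n^'n) set) \<noteq> 0"
    and "emeasure lborel (near_isometries \<epsilon> :: (real^'n^'n) set) \<noteq> \<infinity>"
proof -
  have "0 < measure lborel (ball (mat 1 :: real^'n^'n) \<epsilon>)"
    using assms by (simp add: content_ball_pos)
  then have "0 < emeasure lborel (ball (mat 1 :: real^'n^'n) \<epsilon>)"
    by (simp add: measure_def zero_less_iff_neq_zero) (metis enn2real_0 less_irrefl)
  also have "\<dots> \<le> emeasure lborel (near_isometries \<epsilon> :: (real^'n^'n) set)"
    by (intro emeasure_mono ball_subset_near_isometries) auto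
  finally show "emeasure lborel (near_isometries \<epsilon> :: (real^'n^'n) set) \<noteq> 0" by simp
  show "emeasure lborel (near_isometries \<epsilon> :: (real^'n^'n) set) \<noteq> \<infinity>"
    using emeasure_bounded_finite[OF bounded_near_isometries[of \<epsilon>, where 'n='n]] by simp
qed

definition random_near_isometry :: "real \<Rightarrow> (real^'n^'n) measure" where
  "random_near_isometry \<epsilon> = uniform_measure lborel (near_isometries \<epsilon>)"

lemma sets_random_near_isometry [measurable_cong, simp]: "sets (random_near_isometry \<epsilon>) = sets borel"
  by (simp add: random_near_isometry_def)

lemma space_random_near_isometry [simp]: "space (random_near_isometry \<epsilon>) = UNIV"
  by (simp add: random_near_isometry_def)

lemma prob_space_random_near_isometry: "\<epsilon> > 0 \<Longrightarrow> prob_space (random_near_isometry \<epsilon>)"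
  unfolding random_near_isometry_def
  by (intro prob_space_uniform_measure emeasure_near_isometries)

lemma AE_random_near_isometry:
  "\<epsilon> > 0 \<Longrightarrow> AE A in random_near_isometry \<epsilon>. A \<in> near_isometries \<epsilon>"
  unfolding random_near_isometry_def
  by (intro AE_uniform_measureI) auto

lemma orthogonal_matrix_norm:
  fixes S :: "real^'n^'n"
  assumes "orthogonal_matrix S" shows "norm (S *v w) = norm w"
proof -
  have "orthogonal_transformation (\<lambda>w. S *v w)"
    using assms by (simp add: orthogonal_transformation_matrix)
  then show ?thesis by (rule orthogonal_transformation_norm)
qed

lemma norm_mult_orthogonal_matrix:
  fixes A S :: "real^'n^'n"
  assumes "orthogonal_matrix S" shows "norm (A ** S) = norm A"
proof -
  have "norm ((A ** S) $ i) = norm (A $ i)" for i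
  proof -
    have "(A ** S) $ i = transpose S *v (A $ i)"
      by (simp add: vec_eq_iff matrix_matrix_mult_def matrix_vector_mult_def transpose_def mult.commute)
    then show ?thesis using orthogonal_matrix_norm[of "transpose S" "A $ i"] assms
      by (simp only: orthogonal_matrix_transpose)
  qed
  then show ?thesis by (simp add: norm_vec_def[of "A ** S"] norm_vec_def[of A])
qed

lemma near_isometries_mult_orthogonal:
  assumes S: "orthogonal_matrix S" shows "A ** S \<in> near_isometries \<epsilon> \<longleftrightarrow> A \<in> near_isometries \<epsilon>"
proof -
  have S': "S ** transpose S = mat 1" using S by (simp add: orthogonal_matrix_def)
  have *: "A ** R \<in> near_isometries \<epsilon>" if "orthogonal_matrix R" "A \<in> near_isometries \<epsilon>" for A R
    using near_isometriesD[OF that(2)] orthogonal_matrix_norm[OF that(1)]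
    unfolding near_isometries_def by (simp add: matrix_vector_mul_assoc[symmetric]) metis
  have "A = (A ** S) ** transpose S" by (simp add: matrix_mul_assoc[symmetric] S')
  then show ?thesis using *[OF S, of A] *[of "transpose S" "A ** S"] S by auto
qed

text \<open>
  Right multiplication by an orthogonal matrix is a linear isometry of the Euclidean space of matrices
  and maps the set of near-isometries to itself.
\<close>

lemma random_near_isometry_invariant:
  fixes S :: "real^'n^'n"
  assumes S: "orthogonal_matrix S"
  shows "distr (random_near_isometry \<epsilon>) borel (\<lambda>A. A ** S) = random_near_isometry \<epsilon>"
proof (rule measure_eqI)
  let ?N = "near_isometries \<epsilon> :: (real^'n^'n) set" and ?T = "\<lambda>A::real^'n^'n. A ** S"
  have lin: "linear ?T"
    by (rule linearI) (simp_all add: vec_eq_iff matrix_matrix_mult_def sum_distrib_left mult.assoc sum.distrib distrib_right)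
  have [measurable]: "?T \<in> borel_measurable borel"
    using lin by (intro borel_measurable_continuous_onI linear_continuous_on) (simp add: linear_conv_bounded_linear)
  fix B assume "B \<in> sets (distr (random_near_isometry \<epsilon>) borel ?T)"
  then have B [measurable]: "B \<in> sets borel" by simp
  have vim: "?T -` B \<in> sets borel"
    using measurable_sets[OF \<open>?T \<in> borel_measurable borel\<close> B] by simp
  have "emeasure lborel (?N \<inter> B) = emeasure (distr lborel borel ?T) (?N \<inter> B)"
    by (subst lborel_distr_linear_isometry[OF lin norm_mult_orthogonal_matrix[OF S]]) simp
  also have "\<dots> = emeasure lborel (?T -` (?N \<inter> B))"
    by (subst emeasure_distr) auto
  also have "?T -` (?N \<inter> B) = ?N \<inter> ?T -` B"
    using near_isometries_mult_orthogonal[OF S] by auto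
  finally show "emeasure (distr (random_near_isometry \<epsilon>) borel ?T) B = emeasure (random_near_isometry \<epsilon>) B"
    using vim by (subst emeasure_distr) (auto simp: random_near_isometry_def)
qed simp

section \<open>Uniform measure on a ball\<close>

lemma integral_uniform_measure_lborel:
  fixes f :: "'a::euclidean_space \<Rightarrow> real"
  assumes [measurable]: "A \<in> sets borel" and A: "emeasure lborel A \<noteq> 0" "emeasure lborel A \<noteq> \<infinity>"
    and [measurable]: "f \<in> borel_measurable borel"
  shows "(\<integral>x. f x \<partial>uniform_measure lborel A) = (\<integral>x. indicator A x * f x \<partial>lborel) / measure lborel A"
proof -
  have e: "indicator A x / emeasure lborel A = ennreal (indicator A x / measure lborel A)" for x
  proof -
    have "measure lborel A > 0"
      using A by (simp add: measure_def enn2real_positive_iff less_top[symmetric] zero_less_iff_neq_zero)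
    then show ?thesis
      using A by (simp add: emeasure_eq_ennreal_measure divide_ennreal[symmetric] split: split_indicator)
  qed
  have "(\<integral>x. f x \<partial>uniform_measure lborel A) = (\<integral>x. (indicator A x / measure lborel A) *\<^sub>R f x \<partial>lborel)"
    unfolding uniform_measure_def e by (subst integral_density) (auto simp: measure_nonneg)
  then show ?thesis by simp
qed

lemma measure_ball_pos: "r > 0 \<Longrightarrow> 0 < measure lborel (ball (x::'a::euclidean_space) r)"
  by (rule content_ball_pos)

lemma emeasure_ball_nontrivial:
  "r > 0 \<Longrightarrow> emeasure lborel (ball (x::'a::euclidean_space) r) \<noteq> 0"
  "emeasure lborel (ball (x::'a::euclidean_space) r) \<noteq> \<infinity>"
proof -
  show "r > 0 \<Longrightarrow> emeasure lborel (ball x r) \<noteq> 0"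
    using measure_ball_pos[of r x] by (auto simp: measure_def)
  show "emeasure lborel (ball x r) \<noteq> \<infinity>"
    using emeasure_lborel_ball_finite[of x r] by auto
qed

lemma ball_borel [measurable]: "ball (x::'a::euclidean_space) r \<in> sets borel"
  by simp

lemma emeasure_ball_less_top: "emeasure lborel (ball (x::'a::euclidean_space) r) < top"
  using emeasure_lborel_ball_finite[of x r] by simp

lemma measure_ball_eq: "measure lborel (ball (x::'a::euclidean_space) r) = measure lborel (ball (0::'a) r)"
  by (cases "r \<ge> 0") (simp_all add: content_ball ball_empty)

lemma measure_ball_scale:
  "r \<ge> 0 \<Longrightarrow> measure lborel (ball (x::'a::euclidean_space) r) = r ^ DIM('a) * measure lborel (ball (0::'a) 1)"
  by (simp add: content_ball)

lemma prob_space_uniform_ball: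
  "r > 0 \<Longrightarrow> prob_space (uniform_measure lborel (ball (x::'a::euclidean_space) r))"
  by (intro prob_space_uniform_measure emeasure_ball_nontrivial)

lemma integral_lborel_shift:
  fixes f :: "'a::euclidean_space \<Rightarrow> real"
  assumes [measurable]: "f \<in> borel_measurable borel"
  shows "(\<integral>x. f (x + c) \<partial>lborel) = (\<integral>x. f x \<partial>lborel)"
proof -
  have "(\<integral>x. f x \<partial>lborel) = (\<integral>x. f x \<partial>distr lborel borel ((+) c))"
    by (simp add: lborel_distr_plus)
  also have "\<dots> = (\<integral>x. f (c + x) \<partial>lborel)"
    by (subst integral_distr) auto
  finally show ?thesis by (simp add: add.commute)
qed

text \<open>
  The smaller concentric ball of radius \<open>r - dist a b\<close> lies in the second ball, and Bernoulli's
  inequality bounds the volume of the remaining shell. If \<open>dist a b > r\<close>, the right-hand side exceeds the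
  volume of the ball.
\<close>

lemma measure_ball_minus_ball:
  fixes a b :: "'a::euclidean_space"
  assumes r: "r > 0"
  shows "measure lborel (ball a r - ball b r) \<le> measure lborel (ball (0::'a) r) * (real DIM('a) * dist a b / r)"
proof (cases "dist a b \<le> r")
  case True
  define t where "t = dist a b / r"
  have t: "0 \<le> t" "t \<le> 1" using r True by (auto simp: t_def)
  have fin: "ball x \<rho> \<in> fmeasurable lborel" for x :: 'a and \<rho>
    by (rule fmeasurableI) (auto simp: emeasure_ball_less_top)
  have sub: "ball a (r - dist a b) \<subseteq> ball b r"
    by (smt (verit) dist_commute dist_triangle mem_ball subsetI)
  have "ball a r - ball b r \<subseteq> ball a r - ball a (r - dist a b)" using sub by auto
  then have "measure lborel (ball a r - ball b r) \<le> measure lborel (ball a r - ball a (r - dist a b))"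
    by (intro measure_mono_fmeasurable) (auto intro!: fmeasurable.Diff fin)
  also have "\<dots> = measure lborel (ball a r) - measure lborel (ball a (r - dist a b))"
    using fin by (subst measure_Diff) (auto intro: fin simp: emeasure_ball_less_top[THEN less_imp_neq] subset_ball)
  also have "\<dots> = measure lborel (ball (0::'a) 1) * (r ^ DIM('a) - (r - dist a b) ^ DIM('a))"
    using True r by (simp add: measure_ball_scale[of _ a] algebra_simps)
  also have "r - dist a b = r * (1 - t)" using r by (simp add: t_def algebra_simps)
  also have "r ^ DIM('a) - (r * (1 - t)) ^ DIM('a) = r ^ DIM('a) * (1 - (1 - t) ^ DIM('a))"
    unfolding power_mult_distrib by (simp add: right_diff_distrib)
  also have "\<dots> \<le> r ^ DIM('a) * (real DIM('a) * t)"
    using Bernoulli_inequality[of "-t" "DIM('a)"] t r by (intro mult_left_mono) auto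
  also have "measure lborel (ball (0::'a) 1) * (r ^ DIM('a) * (real DIM('a) * t))
      = measure lborel (ball (0::'a) r) * (real DIM('a) * dist a b / r)"
    using r by (simp add: measure_ball_scale[of r] t_def)
  finally show ?thesis by (simp add: mult_left_mono)
next
  case False
  have "measure lborel (ball a r - ball b r) \<le> measure lborel (ball a r)"
    by (intro measure_mono_fmeasurable) (auto simp: fmeasurableI emeasure_ball_less_top)
  also have "\<dots> = measure lborel (ball (0::'a) r) * 1" by (simp add: measure_ball_eq[of a])
  also have "\<dots> \<le> measure lborel (ball (0::'a) r) * (real DIM('a) * dist a b / r)"
  proof (rule mult_left_mono)
    have "1 * 1 \<le> real DIM('a) * (dist a b / r)"
      using False r DIM_positive[where 'a='a] by (intro mult_mono) (auto simp: Suc_leI)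
    then show "1 \<le> real DIM('a) * dist a b / r" by simp
  qed simp
  finally show ?thesis .
qed

text \<open>
  Shifting the uniform law on a ball by \<open>h\<close> changes it by \<open>O(norm h)\<close> in total variation. All the
  smoothness used in the proof comes from this bound.
\<close>

lemma uniform_ball_shift_bound:
  fixes G :: "'a::euclidean_space \<Rightarrow> real"
  assumes r: "r > 0" and [measurable]: "G \<in> borel_measurable borel" and G: "\<And>x. 0 \<le> G x" "\<And>x. G x \<le> K"
  shows "\<bar>\<integral>y. (G (y + h) - G y) \<partial>uniform_measure lborel (ball a r)\<bar> \<le> K * (real DIM('a) * norm h / r)"
proof -
  have K: "K \<ge> 0" using G order_trans by blast
  let ?B = "ball a r" and ?C = "ball (a + h) r"
  have int: "integrable lborel (\<lambda>y. indicator (ball b \<rho>) y * F y)"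
    if "F \<in> borel_measurable borel" "\<And>x. \<bar>F x\<bar> \<le> K" for F :: "'a \<Rightarrow> real" and b \<rho>
  proof (rule Bochner_Integration.integrable_bound)
    have [measurable]: "F \<in> borel_measurable borel" "ball b \<rho> \<in> sets borel" using that(1) by auto
    show "integrable lborel (\<lambda>y. K * indicator (ball b \<rho>) y)"
      by (intro integrable_mult_right integrable_real_indicator) (auto simp: emeasure_ball_less_top)
    show "(\<lambda>y. indicator (ball b \<rho>) y * F y) \<in> borel_measurable lborel"
      by measurable
    show "AE x in lborel. norm (indicator (ball b \<rho>) x * F x) \<le> norm (K * indicator (ball b \<rho>) x :: real)"
      using that(2) K by (auto split: split_indicator)
  qed
  have G': "\<bar>G x\<bar> \<le> K" for x using G by (simp add: abs_le_iff order_trans[OF _ G(1)])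
  have eq: "(\<integral>y. indicator ?B y * G (y + h) \<partial>lborel) = (\<integral>y. indicator ?C y * G y \<partial>lborel)"
  proof -
    have "(\<integral>y. indicator ?B y * G (y + h) \<partial>lborel) = (\<integral>y. indicator ?C (y + h) * G (y + h) \<partial>lborel)"
      by (intro Bochner_Integration.integral_cong) (auto simp: dist_norm split: split_indicator)
    also have "\<dots> = (\<integral>y. indicator ?C y * G y \<partial>lborel)"
      by (rule integral_lborel_shift) measurable
    finally show ?thesis .
  qed
  have diff: "(\<integral>y. indicator X y * G y \<partial>lborel) - (\<integral>y. indicator Y y * G y \<partial>lborel) \<le> K * measure lborel (X - Y)"
    if X: "X = ball x r" and Y: "Y = ball y r" for X Y x y
  proof -
    have XY: "integrable lborel (\<lambda>z. K * indicator (X - Y) z :: real)"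
      unfolding X by (auto intro!: integrable_mult_right simp: le_less_trans[OF emeasure_mono emeasure_ball_less_top[of x r]] Y)
    have "(\<integral>y. indicator X y * G y \<partial>lborel) - (\<integral>y. indicator Y y * G y \<partial>lborel)
        = (\<integral>y. indicator X y * G y - indicator Y y * G y \<partial>lborel)"
      using G' by (intro Bochner_Integration.integral_diff[symmetric]) (auto simp: X Y intro!: int)
    also have "\<dots> \<le> (\<integral>y. K * indicator (X - Y) y \<partial>lborel)"
      using G G' by (intro integral_mono XY Bochner_Integration.integrable_diff)
        (auto simp: X Y intro!: int split: split_indicator)
    also have "\<dots> = K * measure lborel (X - Y)" by simp
    finally show ?thesis .
  qed
  define m where "m = measure lborel ?B"
  have m: "m > 0" using r by (simp add: m_def measure_ball_pos)
  have m0: "measure lborel (ball (0::'a) r) = m" by (simp add: m_def measure_ball_eq[of a])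
  have "(\<integral>y. (G (y + h) - G y) \<partial>uniform_measure lborel ?B)
      = (\<integral>y. indicator ?B y * (G (y + h) - G y) \<partial>lborel) / m"
    unfolding m_def using r by (intro integral_uniform_measure_lborel emeasure_ball_nontrivial) auto
  also have "(\<integral>y. indicator ?B y * (G (y + h) - G y) \<partial>lborel)
      = (\<integral>y. indicator ?C y * G y \<partial>lborel) - (\<integral>y. indicator ?B y * G y \<partial>lborel)"
    unfolding right_diff_distrib eq[symmetric] using G'
    by (intro Bochner_Integration.integral_diff int) auto
  finally have I: "(\<integral>y. (G (y + h) - G y) \<partial>uniform_measure lborel ?B)
      = ((\<integral>y. indicator ?C y * G y \<partial>lborel) - (\<integral>y. indicator ?B y * G y \<partial>lborel)) / m" .
  have c1: "K * measure lborel (?C - ?B) \<le> K * (m * (real DIM('a) * norm h / r))"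
    using measure_ball_minus_ball[OF r, of "a + h" a] K by (intro mult_left_mono) (auto simp: m0 dist_norm)
  have c2: "K * measure lborel (?B - ?C) \<le> K * (m * (real DIM('a) * norm h / r))"
    using measure_ball_minus_ball[OF r, of a "a + h"] K by (intro mult_left_mono) (auto simp: m0 dist_norm)
  have "\<bar>(\<integral>y. indicator ?C y * G y \<partial>lborel) - (\<integral>y. indicator ?B y * G y \<partial>lborel)\<bar>
      \<le> K * (m * (real DIM('a) * norm h / r))"
    using diff[OF refl refl, of "a + h" a] diff[OF refl refl, of a "a + h"] c1 c2 by linarith
  then show ?thesis unfolding I using m
    by (simp add: abs_divide divide_le_eq mult.commute mult.left_commute)
qed

section \<open>Averages of a measure over balls\<close>

definition ball_average :: "real \<Rightarrow> 'a::euclidean_space measure \<Rightarrow> 'a \<Rightarrow> real" where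
  "ball_average r \<nu> x = measure \<nu> (ball x r) / measure lborel (ball (0::'a) r)"

lemma measure_density_lborel:
  fixes g :: "'a::euclidean_space \<Rightarrow> real"
  assumes [measurable]: "g \<in> borel_measurable borel" "A \<in> sets borel" and g: "\<And>x. 0 \<le> g x"
  shows "measure (density lborel (\<lambda>x. ennreal (g x))) A = (\<integral>y. indicator A y * g y \<partial>lborel)"
proof -
  have "emeasure (density lborel (\<lambda>x. ennreal (g x))) A = (\<integral>\<^sup>+y. ennreal (indicator A y * g y) \<partial>lborel)"
    by (subst emeasure_density) (auto intro!: nn_integral_cong split: split_indicator)
  then show ?thesis using g by (simp add: measure_def integral_eq_nn_integral)
qed

lemma ball_average_density:
  fixes g :: "'a::euclidean_space \<Rightarrow> real"
  assumes r: "r > 0" and [measurable]: "g \<in> borel_measurable borel" and g: "\<And>x. 0 \<le> g x"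
  shows "ball_average r (density lborel (\<lambda>x. ennreal (g x))) x
      = (\<integral>u. g (x + u) \<partial>uniform_measure lborel (ball 0 r))"
proof -
  have [measurable]: "ball x r \<in> sets borel" by simp
  have "(\<integral>u. g (x + u) \<partial>uniform_measure lborel (ball 0 r))
     = (\<integral>u. indicator (ball 0 r) u * g (x + u) \<partial>lborel) / measure lborel (ball (0::'a) r)"
    using r by (intro integral_uniform_measure_lborel emeasure_ball_nontrivial) auto
  also have "(\<integral>u. indicator (ball 0 r) u * g (x + u) \<partial>lborel)
     = (\<integral>u. indicator (ball x r) (u + x) * g (u + x) \<partial>lborel)"
    by (intro Bochner_Integration.integral_cong) (auto simp: dist_norm add.commute split: split_indicator)
  also have "\<dots> = (\<integral>u. indicator (ball x r) u * g u \<partial>lborel)"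
    by (rule integral_lborel_shift) measurable
  finally show ?thesis using g by (simp add: ball_average_def measure_density_lborel)
qed

text \<open>
  By Fubini, the measure whose density is the ball average of \<open>\<nu>\<close> is the average of the translates of
  \<open>\<nu>\<close> by vectors of a ball. Translation-invariant bounds on \<open>\<nu>\<close> therefore pass to it without loss.
\<close>

lemma
  fixes \<nu> :: "'a::euclidean_space measure"
  assumes fin: "finite_measure \<nu>" and [measurable_cong, simp]: "sets \<nu> = sets borel" and r: "r > 0"
  shows ball_average_borel [measurable]: "ball_average r \<nu> \<in> borel_measurable borel"
    and emeasure_ball_average: "A \<in> sets borel \<Longrightarrow>
       emeasure (density lborel (\<lambda>x. ennreal (ball_average r \<nu> x))) A
       = (\<integral>\<^sup>+u. emeasure \<nu> {y. y + u \<in> A} \<partial>uniform_measure lborel (ball 0 r))"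
proof -
  interpret finite_measure \<nu> by fact
  have sp [simp]: "space \<nu> = UNIV" using sets_eq_imp_space_eq[of \<nu> borel] by simp
  let ?m = "measure lborel (ball (0::'a) r)"
  have m: "?m > 0" using r by (rule measure_ball_pos)
  have [measurable]: "Measurable.pred (borel \<Otimes>\<^sub>M borel) (\<lambda>z::'a\<times>'a. dist (fst z) (snd z) < r)"
    by measurable
  have nu: "emeasure \<nu> (ball x r) = (\<integral>\<^sup>+y. indicator {z. dist (fst z) (snd z) < r} (x, y) \<partial>\<nu>)" for x
  proof -
    have "(\<integral>\<^sup>+y. indicator {z. dist (fst z) (snd z) < r} (x, y) \<partial>\<nu>) = (\<integral>\<^sup>+y. indicator (ball x r) y \<partial>\<nu>)"
      by (intro nn_integral_cong) (auto split: split_indicator)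
    then show ?thesis by simp
  qed
  have [measurable]: "(\<lambda>x. emeasure \<nu> (ball x r)) \<in> borel_measurable borel"
    unfolding nu by measurable
  have "(\<lambda>x. enn2real (emeasure \<nu> (ball x r)) / ?m) \<in> borel_measurable borel" by measurable
  then show [measurable]: "ball_average r \<nu> \<in> borel_measurable borel"
    unfolding ball_average_def[abs_def] measure_def .
  assume [measurable]: "A \<in> sets borel"
  have pt: "ennreal (ball_average r \<nu> x) = emeasure \<nu> (ball x r) / emeasure lborel (ball (0::'a) r)" for x
    using m by (simp add: ball_average_def divide_ennreal[symmetric] emeasure_eq_measure
        emeasure_eq_ennreal_measure[of lborel "ball 0 r"] emeasure_ball_less_top[THEN less_imp_neq])
  have "emeasure (density lborel (\<lambda>x. ennreal (ball_average r \<nu> x))) A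
      = (\<integral>\<^sup>+x. (emeasure \<nu> (ball x r) * indicator A x) * inverse (emeasure lborel (ball (0::'a) r)) \<partial>lborel)"
    by (subst emeasure_density) (auto simp: pt divide_ennreal_def mult_ac)
  also have "\<dots> = (\<integral>\<^sup>+x. emeasure \<nu> (ball x r) * indicator A x \<partial>lborel) / emeasure lborel (ball (0::'a) r)"
    unfolding divide_ennreal_def by (rule nn_integral_multc) measurable
  also have "(\<integral>\<^sup>+x. emeasure \<nu> (ball x r) * indicator A x \<partial>lborel)
      = (\<integral>\<^sup>+x. \<integral>\<^sup>+y. indicator {z. dist (fst z) (snd z) < r} (x, y) * indicator A x \<partial>\<nu> \<partial>lborel)"
    unfolding nu by (intro nn_integral_cong nn_integral_multc[symmetric]) measurable
  also have "\<dots> = (\<integral>\<^sup>+y. \<integral>\<^sup>+x. indicator {z. dist (fst z) (snd z) < r} (x, y) * indicator A x \<partial>lborel \<partial>\<nu>)"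
  proof -
    interpret pair_sigma_finite lborel \<nu> by (simp add: pair_sigma_finite_def sigma_finite_lborel sigma_finite_measure_axioms)
    show ?thesis by (rule Fubini'[symmetric]) measurable
  qed
  also have "\<dots> = (\<integral>\<^sup>+y. \<integral>\<^sup>+u. indicator (ball 0 r) u * indicator A (y + u) \<partial>lborel \<partial>\<nu>)"
  proof (rule nn_integral_cong)
    fix y
    have "(\<integral>\<^sup>+x. indicator {z. dist (fst z) (snd z) < r} (x, y) * indicator A x \<partial>lborel)
       = (\<integral>\<^sup>+u. indicator {z. dist (fst z) (snd z) < r} (u + y, y) * indicator A (u + y) \<partial>lborel)"
      by (rule nn_integral_lborel_shift[symmetric]) measurable
    also have "\<dots> = (\<integral>\<^sup>+u. indicator (ball 0 r) u * indicator A (y + u) \<partial>lborel)"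
      by (intro nn_integral_cong) (auto simp: dist_norm add.commute split: split_indicator)
    finally show "(\<integral>\<^sup>+x. indicator {z. dist (fst z) (snd z) < r} (x, y) * indicator A x \<partial>lborel)
       = (\<integral>\<^sup>+u. indicator (ball 0 r) u * indicator A (y + u) \<partial>lborel)" .
  qed
  also have "\<dots> = (\<integral>\<^sup>+u. \<integral>\<^sup>+y. indicator (ball 0 r) u * indicator A (y + u) \<partial>\<nu> \<partial>lborel)"
  proof -
    interpret pair_sigma_finite lborel \<nu> by (simp add: pair_sigma_finite_def sigma_finite_lborel sigma_finite_measure_axioms)
    show ?thesis by (rule Fubini') measurable
  qed
  also have "\<dots> = (\<integral>\<^sup>+u. indicator (ball 0 r) u * emeasure \<nu> {y. y + u \<in> A} \<partial>lborel)"
  proof (rule nn_integral_cong)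
    fix u :: 'a
    have [measurable]: "{y. y + u \<in> A} \<in> sets borel" by measurable
    have "(\<integral>\<^sup>+y. indicator A (y + u) \<partial>\<nu>) = (\<integral>\<^sup>+y. indicator {y. y + u \<in> A} y \<partial>\<nu>)"
      by (intro nn_integral_cong) (auto split: split_indicator)
    then show "(\<integral>\<^sup>+y. indicator (ball 0 r) u * indicator A (y + u) \<partial>\<nu>) = indicator (ball 0 r) u * emeasure \<nu> {y. y + u \<in> A}"
      by (subst nn_integral_cmult) auto
  qed
  also have "\<dots> / emeasure lborel (ball (0::'a) r) = (\<integral>\<^sup>+u. emeasure \<nu> {y. y + u \<in> A} \<partial>uniform_measure lborel (ball 0 r))"
  proof -
    have "(\<lambda>u. emeasure \<nu> {y. y + u \<in> A}) = (\<lambda>u. \<integral>\<^sup>+y. indicator A (y + u) \<partial>\<nu>)"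
    proof
      fix u :: 'a
      have [measurable]: "{y. y + u \<in> A} \<in> sets borel" by measurable
      have "(\<integral>\<^sup>+y. indicator A (y + u) \<partial>\<nu>) = (\<integral>\<^sup>+y. indicator {y. y + u \<in> A} y \<partial>\<nu>)"
        by (intro nn_integral_cong) (auto split: split_indicator)
      then show "emeasure \<nu> {y. y + u \<in> A} = (\<integral>\<^sup>+y. indicator A (y + u) \<partial>\<nu>)" by simp
    qed
    then have [measurable]: "(\<lambda>u. emeasure \<nu> {y. y + u \<in> A}) \<in> borel_measurable borel" by simp
    show ?thesis
      by (subst nn_integral_uniform_measure) (auto simp: mult.commute)
  qed
  finally show "emeasure (density lborel (\<lambda>x. ennreal (ball_average r \<nu> x))) A
       = (\<integral>\<^sup>+u. emeasure \<nu> {y. y + u \<in> A} \<partial>uniform_measure lborel (ball 0 r))" .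
qed

lemma ball_average_nonneg: "0 \<le> ball_average r \<nu> x"
  by (simp add: ball_average_def)

lemma prob_space_density_iff:
  fixes f :: "'a::euclidean_space \<Rightarrow> real"
  assumes [measurable]: "f \<in> borel_measurable borel" and f: "\<And>x. 0 \<le> f x"
  shows "prob_space (density lborel (\<lambda>x. ennreal (f x))) \<longleftrightarrow> integrable lborel f \<and> (\<integral>x. f x \<partial>lborel) = 1"
proof -
  have "prob_space (density lborel (\<lambda>x. ennreal (f x))) \<longleftrightarrow> (\<integral>\<^sup>+x. ennreal (f x) \<partial>lborel) = 1"
  proof -
    have "emeasure (density lborel (\<lambda>x. ennreal (f x))) UNIV = (\<integral>\<^sup>+x. ennreal (f x) \<partial>lborel)"
      by (subst emeasure_density) auto
    then show ?thesis
      by (auto intro!: prob_spaceI dest: prob_space.emeasure_space_1)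
  qed
  also have "\<dots> \<longleftrightarrow> integrable lborel f \<and> (\<integral>x. f x \<partial>lborel) = 1"
    using nn_integral_eq_integrable[of f lborel 1] f by simp
  finally show ?thesis .
qed

lemma prob_space_ball_average:
  fixes \<nu> :: "'a::euclidean_space measure"
  assumes \<nu>: "prob_space \<nu>" and sets: "sets \<nu> = sets borel" and r: "r > 0"
  shows "prob_space (density lborel (\<lambda>x. ennreal (ball_average r \<nu> x)))"
proof (rule prob_spaceI)
  interpret prob_space \<nu> by fact
  interpret U: prob_space "uniform_measure lborel (ball (0::'a) r)" using r by (rule prob_space_uniform_ball)
  have sp: "space \<nu> = UNIV" using sets_eq_imp_space_eq[OF sets] by simp
  show "emeasure (density lborel (\<lambda>x. ennreal (ball_average r \<nu> x))) (space (density lborel (\<lambda>x. ennreal (ball_average r \<nu> x)))) = 1"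
    using emeasure_ball_average[OF finite_measure_axioms sets r, of UNIV] emeasure_space_1 U.emeasure_space_1
    by (simp add: sp)
qed

section \<open>The law of a random triangle\<close>

text \<open>
  A ball that stays away from the origin and is small compared with the unit ball: the length of
  its random point is the side of the random triangle, which thus neither degenerates nor leaves the region
  where the density under study lives.
\<close>

definition side_ball :: "(real^'n) set" where
  "side_ball = ball (SOME y. norm y = 1/8) (1/16)"

lemma side_ballD:
  assumes "y \<in> (side_ball :: (real^'n) set)"
  shows "1/16 \<le> norm y" "norm y \<le> 3/16"
proof -
  let ?c = "SOME y::real^'n. norm y = 1/8"
  have "norm ((1/8) *\<^sub>R axis undefined 1 :: real^'n) = 1/8" by simp
  then have c: "norm ?c = 1/8" by (rule someI)
  have "norm (?c - y) < 1/16" using assms by (simp add: side_ball_def dist_norm)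
  with c show "1/16 \<le> norm y" "norm y \<le> 3/16"
    using norm_triangle_ineq3[of ?c y] by linarith+
qed

definition random_side :: "(real^'n) measure" where
  "random_side = uniform_measure lborel side_ball"

lemma sets_random_side [measurable_cong, simp]: "sets random_side = sets borel"
  by (simp add: random_side_def)

lemma space_random_side [simp]: "space random_side = UNIV"
  by (simp add: random_side_def)

lemma prob_space_random_side: "prob_space random_side"
  unfolding random_side_def side_ball_def by (rule prob_space_uniform_ball) simp

lemma AE_random_side: "AE y in random_side. y \<in> side_ball"
  unfolding random_side_def side_ball_def
  by (intro AE_uniform_measureI) auto

definition triangle_law :: "real \<Rightarrow> ((real^'n) \<times> (real^'n^'n)) measure" where
  "triangle_law \<epsilon> = random_side \<Otimes>\<^sub>M random_near_isometry \<epsilon>"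

lemma sets_triangle_law [measurable_cong, simp]: "sets (triangle_law \<epsilon>) = sets (borel \<Otimes>\<^sub>M borel)"
  unfolding triangle_law_def by (rule sets_pair_measure_cong) simp_all

lemma space_triangle_law [simp]: "space (triangle_law \<epsilon>) = UNIV"
  by (simp add: triangle_law_def space_pair_measure)

lemma prob_space_triangle_law: "\<epsilon> > 0 \<Longrightarrow> prob_space (triangle_law \<epsilon>)"
  unfolding triangle_law_def
  by (intro prob_space_pair prob_space_random_side prob_space_random_near_isometry)

lemma AE_triangle_law:
  assumes "\<epsilon> > 0"
  shows "AE \<omega> in triangle_law \<epsilon> :: ((real^'n) \<times> (real^'n^'n)) measure. fst \<omega> \<in> side_ball \<and> snd \<omega> \<in> near_isometries \<epsilon>"
proof -
  interpret Y: prob_space "random_side :: (real^'n) measure" by (rule prob_space_random_side)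
  interpret A: prob_space "random_near_isometry \<epsilon> :: (real^'n^'n) measure"
    using assms by (rule prob_space_random_near_isometry)
  interpret YA: pair_prob_space "random_side :: (real^'n) measure" "random_near_isometry \<epsilon> :: (real^'n^'n) measure" ..
  have [measurable]: "(side_ball :: (real^'n) set) \<in> sets borel" by (simp add: side_ball_def)
  show ?thesis unfolding triangle_law_def
  proof (rule YA.AE_pair_measure)
    show "AE y in random_side. AE A in random_near_isometry \<epsilon>.
        fst (y, A) \<in> side_ball \<and> snd (y, A) \<in> near_isometries \<epsilon>"
      using AE_random_side
    proof eventually_elim
      case (elim y)
      then show ?case using AE_random_near_isometry[OF assms] by simp
    qed
  qed measurable
qed

text \<open>
  The edge vector of the random triangle in direction \<open>w\<close>: the near-isometry rotates \<open>w\<close>, and the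
  length of the random vector \<open>fst \<omega>\<close> scales it. In \<open>integral_arm_exchange\<close> this random vector
  itself takes the place of \<open>w\<close>.
\<close>

definition arm :: "(real^'n) \<times> (real^'n^'n) \<Rightarrow> real^'n \<Rightarrow> real^'n" where
  "arm \<omega> w = norm (fst \<omega>) *\<^sub>R (snd \<omega> *v w)"

lemma arm_diff: "arm \<omega> (v - w) = arm \<omega> v - arm \<omega> w"
  by (simp add: arm_def matrix_vector_mult_diff_distrib scaleR_right_diff_distrib)

lemma arm_minus: "arm \<omega> (- w) = - arm \<omega> w"
  using arm_diff[of \<omega> 0 w] by (simp add: arm_def)

lemma measurable_matrix_apply [measurable]:
  fixes f :: "'b \<Rightarrow> real^'n^'n" and g :: "'b \<Rightarrow> real^'n"
  assumes "f \<in> borel_measurable M" "g \<in> borel_measurable M"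
  shows "(\<lambda>x. f x *v g x) \<in> borel_measurable M"
  by (rule borel_measurable_continuous_Pair[OF assms]) (intro continuous_intros)

lemma measurable_arm [measurable]: "(\<lambda>\<omega>. arm \<omega> w) \<in> borel_measurable (triangle_law \<epsilon>)"
  unfolding arm_def by measurable

text \<open>
  The right invariance of the near-isometry, with a further independent coordinate carried along.
\<close>

lemma triangle_law_rotation:
  fixes S :: "real^'n^'n" and \<phi> :: "'b \<times> (real^'n) \<times> (real^'n^'n) \<Rightarrow> real"
  assumes "\<epsilon> > 0" and S: "orthogonal_matrix S" and Q: "sigma_finite_measure Q"
    and [measurable]: "\<phi> \<in> borel_measurable (Q \<Otimes>\<^sub>M triangle_law \<epsilon>)"
  shows "(\<integral>z. \<phi> (fst z, fst (snd z), snd (snd z) ** S) \<partial>(Q \<Otimes>\<^sub>M triangle_law \<epsilon>))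
       = (\<integral>z. \<phi> z \<partial>(Q \<Otimes>\<^sub>M triangle_law \<epsilon>))"
proof -
  let ?N = "random_near_isometry \<epsilon> :: (real^'n^'n) measure" and ?L = "triangle_law \<epsilon>"
  let ?T = "\<lambda>A::real^'n^'n. A ** S"
  have [measurable]: "?T \<in> borel_measurable borel"
    unfolding matrix_matrix_mult_def by (intro borel_measurable_continuous_onI continuous_intros)
  interpret Y: prob_space "random_side :: (real^'n) measure" by (rule prob_space_random_side)
  interpret N: prob_space ?N using \<open>\<epsilon> > 0\<close> by (rule prob_space_random_near_isometry)
  interpret L: prob_space ?L using \<open>\<epsilon> > 0\<close> by (rule prob_space_triangle_law)
  have "?L = distr random_side random_side (\<lambda>y. y) \<Otimes>\<^sub>M distr ?N borel ?T"
    by (simp add: random_near_isometry_invariant[OF S] triangle_law_def)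
  also have "\<dots> = distr (random_side \<Otimes>\<^sub>M ?N) (random_side \<Otimes>\<^sub>M borel) (\<lambda>(y,A). (y, ?T A))"
    by (subst pair_measure_distr) (auto simp: random_near_isometry_invariant[OF S] N.sigma_finite_measure_axioms)
  also have "\<dots> = distr ?L ?L (\<lambda>(y,A). (y, ?T A))"
    by (intro distr_cong) (auto simp: triangle_law_def intro!: sets_pair_measure_cong)
  finally have L: "distr ?L ?L (\<lambda>(y,A). (y, ?T A)) = ?L" by simp
  have [measurable]: "(\<lambda>(y,A). (y, ?T A)) \<in> measurable ?L ?L" by measurable
  have "distr Q Q (\<lambda>x. x) \<Otimes>\<^sub>M distr ?L ?L (\<lambda>(y,A). (y, ?T A))
      = distr (Q \<Otimes>\<^sub>M ?L) (Q \<Otimes>\<^sub>M ?L) (\<lambda>(x,\<omega>). (x, (\<lambda>(y,A). (y, ?T A)) \<omega>))"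
    by (intro pair_measure_distr) (auto simp: L L.sigma_finite_measure_axioms)
  then have "Q \<Otimes>\<^sub>M ?L = distr (Q \<Otimes>\<^sub>M ?L) (Q \<Otimes>\<^sub>M ?L) (\<lambda>z. (fst z, fst (snd z), snd (snd z) ** S))"
    by (simp add: L L[unfolded case_prod_unfold] case_prod_unfold)
  then have "(\<integral>z. \<phi> z \<partial>(Q \<Otimes>\<^sub>M ?L)) = (\<integral>z. \<phi> z \<partial>distr (Q \<Otimes>\<^sub>M ?L) (Q \<Otimes>\<^sub>M ?L) (\<lambda>z. (fst z, fst (snd z), snd (snd z) ** S)))"
    by simp
  also have "\<dots> = (\<integral>z. \<phi> (fst z, fst (snd z), snd (snd z) ** S) \<partial>(Q \<Otimes>\<^sub>M ?L))"
    by (rule integral_distr) measurable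
  finally show ?thesis by simp
qed

text \<open>
  The vectors \<open>norm y *\<^sub>R w\<close> and \<open>norm w *\<^sub>R y\<close> have the same length, so some orthogonal matrix
  maps one to the other, and right invariance absorbs it. The random vector \<open>y\<close>, which has a density in the full
  space, then takes the place of the fixed vector \<open>w\<close>.
\<close>

lemma integral_arm_exchange:
  fixes \<phi> :: "real^'n \<Rightarrow> real"
  assumes "\<epsilon> > 0" and [measurable]: "\<phi> \<in> borel_measurable borel" and B: "\<And>x. \<bar>\<phi> x\<bar> \<le> B"
  shows "(\<integral>\<omega>. \<phi> (arm \<omega> w) \<partial>triangle_law \<epsilon>)
       = (\<integral>A. \<integral>y. \<phi> (norm w *\<^sub>R (A *v y)) \<partial>random_side \<partial>random_near_isometry \<epsilon>)"
proof -
  let ?N = "random_near_isometry \<epsilon> :: (real^'n^'n) measure" and ?Y = "random_side :: (real^'n) measure"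
  interpret Y: prob_space ?Y by (rule prob_space_random_side)
  interpret N: prob_space ?N using \<open>\<epsilon> > 0\<close> by (rule prob_space_random_near_isometry)
  interpret YN: pair_prob_space ?Y ?N ..
  have rot: "(\<integral>A. \<phi> (norm y *\<^sub>R (A *v w)) \<partial>?N) = (\<integral>A. \<phi> (norm w *\<^sub>R (A *v y)) \<partial>?N)" for y
  proof -
    have "norm (norm y *\<^sub>R w) = norm (norm w *\<^sub>R y)" by simp
    then obtain f where f: "orthogonal_transformation f" "f (norm y *\<^sub>R w) = norm w *\<^sub>R y"
      using orthogonal_transformation_exists by blast
    define S where "S = matrix f"
    have S: "orthogonal_matrix S" and lin: "linear f"
      using f(1) by (auto simp: S_def orthogonal_transformation_matrix)
    have Sf: "S *v x = f x" for x
      using lin by (simp add: S_def)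
    have [measurable]: "(\<lambda>A. A ** S) \<in> borel_measurable borel"
      unfolding matrix_matrix_mult_def by (intro borel_measurable_continuous_onI continuous_intros)
    have eq: "norm y *\<^sub>R ((A ** S) *v w) = norm w *\<^sub>R (A *v y)" for A
    proof -
      have "norm y *\<^sub>R ((A ** S) *v w) = A *v (S *v (norm y *\<^sub>R w))"
        unfolding matrix_vector_mul_assoc[symmetric] by (simp only: matrix_vector_mult_scaleR)
      also have "S *v (norm y *\<^sub>R w) = norm w *\<^sub>R y" by (simp only: Sf f(2))
      also have "A *v (norm w *\<^sub>R y) = norm w *\<^sub>R (A *v y)" by (rule matrix_vector_mult_scaleR)
      finally show ?thesis .
    qed
    have "(\<integral>A. \<phi> (norm y *\<^sub>R (A *v w)) \<partial>?N) = (\<integral>A. \<phi> (norm y *\<^sub>R (A *v w)) \<partial>distr ?N borel (\<lambda>A. A ** S))"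
      by (simp add: random_near_isometry_invariant[OF S])
    also have "\<dots> = (\<integral>A. \<phi> (norm y *\<^sub>R ((A ** S) *v w)) \<partial>?N)"
      by (rule integral_distr) measurable
    also have "\<dots> = (\<integral>A. \<phi> (norm w *\<^sub>R (A *v y)) \<partial>?N)"
      by (simp only: eq)
    finally show ?thesis .
  qed
  have i1: "integrable (?Y \<Otimes>\<^sub>M ?N) (\<lambda>\<omega>. \<phi> (arm \<omega> w))"
    using B by (intro YN.P.integrable_const_bound[of _ B]) (auto simp: arm_def)
  have i2: "integrable (?Y \<Otimes>\<^sub>M ?N) (\<lambda>(y,A). \<phi> (norm w *\<^sub>R (A *v y)))"
    using B by (intro YN.P.integrable_const_bound[of _ B]) (auto simp: case_prod_unfold)
  have "(\<integral>\<omega>. \<phi> (arm \<omega> w) \<partial>triangle_law \<epsilon>) = (\<integral>y. \<integral>A. \<phi> (norm y *\<^sub>R (A *v w)) \<partial>?N \<partial>?Y)"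
    unfolding triangle_law_def using YN.integral_fst'[OF i1] by (simp add: arm_def)
  also have "\<dots> = (\<integral>A. \<integral>y. \<phi> (norm w *\<^sub>R (A *v y)) \<partial>?Y \<partial>?N)"
    unfolding rot by (rule YN.Fubini_integral[OF i2, symmetric])
  finally show ?thesis .
qed

lemma near_isometry_surj:
  assumes A: "A \<in> near_isometries \<epsilon>" and "\<epsilon> \<le> 1/2"
  obtains h where "A *v h = u" "norm h \<le> 2 * norm u"
proof -
  have half: "norm w \<le> 2 * norm (A *v w)" for w
    using near_isometriesD(1)[OF A, of w] mult_right_mono[of "1/2" "1-\<epsilon>" "norm w"] assms(2) by simp
  have "inj (\<lambda>w. A *v w)"
  proof (rule linear_injective_0[THEN iffD2, rule_format])
    fix x assume "A *v x = 0"
    then show "x = 0" using half[of x] by simp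
  qed simp
  then have "surj (\<lambda>w. A *v w)"
    using linear_injective_imp_surjective[of "\<lambda>w. A *v w"] by simp
  then obtain h where "A *v h = u" by (metis surjD)
  with half[of h] that show ?thesis by blast
qed

text \<open>
  After \<open>integral_arm_exchange\<close> and for a fixed near-isometry \<open>A\<close>, the argument of \<open>g\<close> is an affine
  image of the uniform random vector \<open>y\<close>. A displacement of the argument by \<open>u\<close> with \<open>norm u < r\<close> amounts to
  a displacement of \<open>y\<close> by at most \<open>2 * r / norm w\<close>, and \<open>uniform_ball_shift_bound\<close> applies. Replacing \<open>g\<close>
  by its average over balls of radius \<open>r\<close> is an average of such displacements.
\<close>

lemma random_arm_smooths:
  fixes g :: "real^'n \<Rightarrow> real"
  assumes "\<epsilon> > 0" "\<epsilon> \<le> 1/2" and r: "r > 0" and "w \<noteq> 0"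
    and [measurable]: "g \<in> borel_measurable borel" and g: "\<And>x. 0 \<le> g x" "\<And>x. g x \<le> K"
  shows "\<bar>\<integral>\<omega>. (ball_average r (density lborel (\<lambda>x. ennreal (g x))) (x + arm \<omega> w) - g (x + arm \<omega> w)) \<partial>triangle_law \<epsilon>\<bar>
      \<le> K * (32 * real CARD('n) * r / norm w)"
proof -
  let ?N = "random_near_isometry \<epsilon> :: (real^'n^'n) measure" and ?Y = "random_side :: (real^'n) measure"
  let ?U = "uniform_measure lborel (ball (0::real^'n) r)"
  interpret Y: prob_space ?Y by (rule prob_space_random_side)
  interpret N: prob_space ?N using \<open>\<epsilon> > 0\<close> by (rule prob_space_random_near_isometry)
  interpret U: prob_space ?U using r by (rule prob_space_uniform_ball)
  interpret YU: pair_prob_space ?Y ?U ..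
  have K: "K \<ge> 0" using g order_trans by blast
  have gK: "\<bar>g x\<bar> \<le> K" for x using g by (simp add: abs_le_iff order_trans[OF _ g(1)])
  define \<Delta> where "\<Delta> z = (\<integral>u. (g (z + u) - g z) \<partial>?U)" for z
  have [measurable]: "\<Delta> \<in> borel_measurable borel" unfolding \<Delta>_def by measurable
  have iU: "integrable ?U (\<lambda>u. g (z + u))" for z
    using gK by (intro U.integrable_const_bound[of _ K]) auto
  have U1: "measure ?U UNIV = 1" using U.prob_space by simp
  have avg: "ball_average r (density lborel (\<lambda>x. ennreal (g x))) z - g z = \<Delta> z" for z
    unfolding ball_average_density[OF r \<open>g \<in> borel_measurable borel\<close> g(1)] \<Delta>_def
    by (simp add: iU U1)
  have d2: "\<bar>g a - g b\<bar> \<le> K" for a b using g[of a] g[of b] by (simp add: abs_le_iff)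
  have \<Delta>K: "\<bar>\<Delta> z\<bar> \<le> K" for z
    unfolding \<Delta>_def using d2 by (intro order_trans[OF integral_abs_bound] U.integral_le_const) (auto simp: iU)
  have bound: "\<bar>\<integral>y. \<Delta> (x + norm w *\<^sub>R (A *v y)) \<partial>?Y\<bar> \<le> K * (32 * real CARD('n) * r / norm w)"
    if A: "A \<in> near_isometries \<epsilon>" for A
  proof -
    have int: "integrable (?Y \<Otimes>\<^sub>M ?U) (\<lambda>(y,u). g (x + norm w *\<^sub>R (A *v y) + u) - g (x + norm w *\<^sub>R (A *v y)))"
      using d2 by (intro YU.P.integrable_const_bound[of _ K]) (auto simp: case_prod_unfold)
    have "(\<integral>y. \<Delta> (x + norm w *\<^sub>R (A *v y)) \<partial>?Y)
       = (\<integral>u. \<integral>y. (g (x + norm w *\<^sub>R (A *v y) + u) - g (x + norm w *\<^sub>R (A *v y))) \<partial>?Y \<partial>?U)"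
      unfolding \<Delta>_def by (rule YU.Fubini_integral[OF int, symmetric])
    also have "\<bar>\<dots>\<bar> \<le> (\<integral>u. \<bar>\<integral>y. (g (x + norm w *\<^sub>R (A *v y) + u) - g (x + norm w *\<^sub>R (A *v y))) \<partial>?Y\<bar> \<partial>?U)"
      by (rule integral_abs_bound)
    also have "\<dots> \<le> K * (32 * real CARD('n) * r / norm w)"
    proof (rule U.integral_le_const)
      show "integrable ?U (\<lambda>u. \<bar>\<integral>y. (g (x + norm w *\<^sub>R (A *v y) + u) - g (x + norm w *\<^sub>R (A *v y))) \<partial>?Y\<bar>)"
        using YU.integrable_snd[OF int] by auto
      have "AE u in ?U. u \<in> ball 0 r" by (intro AE_uniform_measureI) auto
      then show "AE u in ?U. \<bar>\<integral>y. (g (x + norm w *\<^sub>R (A *v y) + u) - g (x + norm w *\<^sub>R (A *v y))) \<partial>?Y\<bar> \<le> K * (32 * real CARD('n) * r / norm w)"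
      proof eventually_elim
        fix u :: "real^'n" assume "u \<in> ball 0 r"
        then have u: "norm u < r" by simp
        obtain h where h: "A *v h = u /\<^sub>R norm w" "norm h \<le> 2 * norm (u /\<^sub>R norm w)"
          using near_isometry_surj[OF A \<open>\<epsilon> \<le> 1/2\<close>] by blast
        have nh: "norm h \<le> 2 * r / norm w"
        proof -
          have "norm h \<le> 2 * norm u / norm w" using h(2) by (simp add: divide_inverse mult_ac)
          also have "\<dots> \<le> 2 * r / norm w" using u by (intro divide_right_mono) auto
          finally show ?thesis .
        qed
        let ?G = "\<lambda>y. g (x + norm w *\<^sub>R (A *v y))"
        have "g (x + norm w *\<^sub>R (A *v y) + u) = ?G (y + h)" for y
          using \<open>w \<noteq> 0\<close> by (simp add: matrix_vector_right_distrib h(1) scaleR_add_right add.assoc)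
        then have "\<bar>\<integral>y. (g (x + norm w *\<^sub>R (A *v y) + u) - g (x + norm w *\<^sub>R (A *v y))) \<partial>?Y\<bar>
            = \<bar>\<integral>y. (?G (y + h) - ?G y) \<partial>?Y\<bar>" by simp
        also have "\<dots> \<le> K * (real DIM(real^'n) * norm h / (1/16))"
          unfolding random_side_def side_ball_def using g by (intro uniform_ball_shift_bound) auto
        also have "\<dots> \<le> K * (32 * real CARD('n) * r / norm w)"
          using nh K mult_left_mono[OF nh, of "16 * real CARD('n)"] by (intro mult_left_mono) (auto simp: mult_ac)
        finally show "\<bar>\<integral>y. (g (x + norm w *\<^sub>R (A *v y) + u) - g (x + norm w *\<^sub>R (A *v y))) \<partial>?Y\<bar> \<le> K * (32 * real CARD('n) * r / norm w)" .
      qed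
    qed
    finally show ?thesis .
  qed
  have "(\<integral>\<omega>. \<Delta> (x + arm \<omega> w) \<partial>triangle_law \<epsilon>) = (\<integral>A. \<integral>y. \<Delta> (x + norm w *\<^sub>R (A *v y)) \<partial>?Y \<partial>?N)"
    using \<Delta>K \<open>\<epsilon> > 0\<close> by (intro integral_arm_exchange[of \<epsilon> "\<lambda>z. \<Delta> (x + z)"]) auto
  also have "\<bar>\<dots>\<bar> \<le> (\<integral>A. \<bar>\<integral>y. \<Delta> (x + norm w *\<^sub>R (A *v y)) \<partial>?Y\<bar> \<partial>?N)"
    by (rule integral_abs_bound)
  also have "\<dots> \<le> K * (32 * real CARD('n) * r / norm w)"
  proof (rule N.integral_le_const)
    have *: "AE A in ?N. \<bar>\<integral>y. \<Delta> (x + norm w *\<^sub>R (A *v y)) \<partial>?Y\<bar> \<le> K * (32 * real CARD('n) * r / norm w)"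
      using AE_random_near_isometry[OF \<open>\<epsilon> > 0\<close>] by eventually_elim (rule bound)
    then show "AE A in ?N. \<bar>\<integral>y. \<Delta> (x + norm w *\<^sub>R (A *v y)) \<partial>?Y\<bar> \<le> K * (32 * real CARD('n) * r / norm w)" .
    show "integrable ?N (\<lambda>A. \<bar>\<integral>y. \<Delta> (x + norm w *\<^sub>R (A *v y)) \<partial>?Y\<bar>)"
      using * by (intro N.integrable_const_bound[of _ "K * (32 * real CARD('n) * r / norm w)"]) auto
  qed
  finally show ?thesis by (simp add: avg)
qed

section \<open>Rotating one vertex about the opposite side\<close>

text \<open>
  Write \<open>v\<close> as \<open>u / 2\<close> plus a multiple of a unit vector \<open>p\<close> orthogonal to \<open>u\<close>. Dimension three leaves a
  unit vector \<open>q\<close> orthogonal to \<open>u\<close> and \<open>p\<close>, and the reflection exchanging \<open>p\<close> with a unit vector \<open>P s\<close> of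
  the plane of \<open>p\<close> and \<open>q\<close> fixes \<open>u\<close>. The parameter \<open>s\<close> is the coordinate of \<open>P s\<close> along \<open>q\<close>, so that
  distinct parameters give vectors at least as far apart as the parameters, up to a constant.
\<close>

lemma rotations_about_axis:
  fixes u v :: "real^'n"
  assumes card: "CARD('n) \<ge> 3" and uv: "norm u = 1" "norm v = 1" "u \<bullet> v = 1/2"
  obtains S :: "real \<Rightarrow> real^'n^'n"
  where "\<And>s. orthogonal_matrix (S s)" "\<And>s. S s *v u = u"
    "\<And>s t. \<lbrakk>0 \<le> s; s \<le> 1; 0 \<le> t; t \<le> 1\<rbrakk> \<Longrightarrow> \<bar>s - t\<bar> / 2 \<le> norm (S s *v v - S t *v v)"
proof -
  have uu: "u \<bullet> u = 1" and vv: "v \<bullet> v = 1" using uv by (simp_all add: norm_eq_1)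
  define \<kappa> where "\<kappa> = sqrt 3 / 2"
  have \<kappa>: "\<kappa> \<noteq> 0" "\<kappa> * \<kappa> = 3/4" "\<kappa> \<ge> 1/2" by (auto simp: \<kappa>_def)
  define p where "p = (v - u /\<^sub>R 2) /\<^sub>R \<kappa>"
  have up: "u \<bullet> p = 0" using uv uu by (simp add: p_def inner_diff_right)
  have pp: "p \<bullet> p = 1"
  proof -
    define d where "d = v - u /\<^sub>R 2"
    have "d \<bullet> d = \<kappa> * \<kappa>"
      using uv uu vv \<kappa> by (simp add: d_def inner_diff_left inner_diff_right inner_commute)
    moreover have "p = d /\<^sub>R \<kappa>" by (simp only: p_def d_def)
    ultimately show ?thesis using \<kappa>(1) by (simp add: field_simps)
  qed
  have v: "v = u /\<^sub>R 2 + \<kappa> *\<^sub>R p" using \<kappa> by (simp add: p_def)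
  have "dim {u, p} \<le> card {u, p}" by (rule dim_le_card) (auto intro: span_base)
  also have "card {u, p} \<le> 2" by (simp add: card_insert_if)
  finally have "dim {u, p} < DIM(real^'n)" using card by simp
  then obtain x where x: "x \<noteq> 0" "\<And>y. y \<in> span {u, p} \<Longrightarrow> orthogonal x y"
    using orthogonal_to_subspace_exists by blast
  define q where "q = x /\<^sub>R norm x"
  have qq: "q \<bullet> q = 1" using x by (simp add: q_def dot_square_norm power2_eq_square)
  have qu: "q \<bullet> u = 0" "q \<bullet> p = 0" using x(2)[of u] x(2)[of p]
    by (auto simp: q_def orthogonal_def span_base)
  define P where "P s = sqrt (1 - s\<^sup>2) *\<^sub>R p + s *\<^sub>R q" for s
  have PP: "P s \<bullet> P s = 1" if "0 \<le> s" "s \<le> 1" for s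
  proof -
    have "s\<^sup>2 \<le> 1" using that by (simp add: power_le_one)
    then have "sqrt (1 - s\<^sup>2) * sqrt (1 - s\<^sup>2) = 1 - s\<^sup>2" by simp
    then show ?thesis using qq pp qu
      by (simp add: P_def inner_add_left inner_add_right inner_commute power2_eq_square)
  qed
  have Pu: "u \<bullet> P s = 0" for s using up qu by (simp add: P_def inner_add_right inner_commute)
  \<comment> \<open>R s is the reflection in the hyperplane orthogonal to a s; for a s = 0 the quotient is 0 and R s the identity.\<close>
  define a where "a s = p - P s" for s
  define R where "R s x = x - (2 * (a s \<bullet> x) / (a s \<bullet> a s)) *\<^sub>R a s" for s x
  have linR: "linear (R s)" for s
    by (rule linearI) (simp_all add: R_def inner_add_right algebra_simps add_divide_distrib)
  have Ro: "orthogonal_transformation (R s)" for s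
    unfolding orthogonal_transformation_def
  proof (intro conjI allI linR)
    fix x y
    show "R s x \<bullet> R s y = x \<bullet> y"
      by (cases "a s = 0")
        (simp_all add: R_def inner_diff_left inner_diff_right inner_commute field_simps)
  qed
  have Ru: "R s u = u" for s
  proof -
    have "a s \<bullet> u = u \<bullet> p - u \<bullet> P s" by (simp only: a_def inner_diff_right inner_commute[of _ u])
    then show ?thesis by (simp add: R_def up Pu)
  qed
  have Rp: "R s p = P s" if "0 \<le> s" "s \<le> 1" for s
  proof (cases "a s = 0")
    case False
    have "a s \<bullet> a s = 2 * (a s \<bullet> p)"
      using PP[OF that] pp by (simp add: a_def inner_diff_left inner_diff_right inner_commute)
    moreover have "a s \<bullet> a s \<noteq> 0" using False by simp
    ultimately have "2 * (a s \<bullet> p) / (a s \<bullet> a s) = 1" by (metis divide_self)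
    then have "R s p = p - a s" by (simp only: R_def scaleR_one)
    then show ?thesis by (simp add: a_def)
  qed (simp add: R_def a_def)
  have Rv: "R s v = u /\<^sub>R 2 + \<kappa> *\<^sub>R P s" if "0 \<le> s" "s \<le> 1" for s
  proof -
    have "R s v = R s (u /\<^sub>R 2) + R s (\<kappa> *\<^sub>R p)" by (subst v) (rule linear_add[OF linR])
    also have "\<dots> = R s u /\<^sub>R 2 + \<kappa> *\<^sub>R R s p" by (simp only: linear_scale[OF linR])
    finally show ?thesis by (simp only: Ru Rp[OF that])
  qed
  show thesis
  proof (rule that[of "\<lambda>s. matrix (R s)"])
    show "orthogonal_matrix (matrix (R s))" for s
      using Ro by (simp add: orthogonal_transformation_matrix)
    show "matrix (R s) *v u = u" for s using linR by (simp add: Ru)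
    fix s t :: real assume st: "0 \<le> s" "s \<le> 1" "0 \<le> t" "t \<le> 1"
    have "s - t = q \<bullet> (P s - P t)" using qq qu by (simp add: P_def inner_diff_right inner_add_right)
    then have "\<bar>s - t\<bar> \<le> norm q * norm (P s - P t)" by (metis Cauchy_Schwarz_ineq2)
    also have "norm q = 1" using qq by (simp add: norm_eq_1)
    finally have "\<bar>s - t\<bar> / 2 \<le> \<kappa> * norm (P s - P t)"
      using \<kappa> mult_mono[of "1/2" \<kappa> "\<bar>s - t\<bar>" "norm (P s - P t)"] by simp
    also have "\<dots> = norm (matrix (R s) *v v - matrix (R t) *v v)"
    proof -
      have "matrix (R s) *v v - matrix (R t) *v v = \<kappa> *\<^sub>R (P s - P t)"
        using linR st by (simp add: Rv scaleR_right_diff_distrib)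
      then show ?thesis using \<kappa> by simp
    qed
    finally show "\<bar>s - t\<bar> / 2 \<le> norm (matrix (R s) *v v - matrix (R t) *v v)" .
  qed
qed

section \<open>The triangle form and smoothing of one argument\<close>

text \<open>
  The weighted count of triangles with vertices \<open>x\<close>, \<open>x + arm \<omega> u\<close>, \<open>x + arm \<omega> v\<close>. The proof takes
  unit vectors with \<open>u \<bullet> v = 1/2\<close>, which makes these triangles nearly equilateral.
\<close>

definition triangle_form ::
    "real \<Rightarrow> real^'n \<Rightarrow> real^'n \<Rightarrow> (real^'n \<Rightarrow> real) \<Rightarrow> (real^'n \<Rightarrow> real) \<Rightarrow> (real^'n \<Rightarrow> real) \<Rightarrow> real" where
  "triangle_form \<epsilon> u v f g h =
     (\<integral>z. f (fst z) * g (fst z + arm (snd z) u) * h (fst z + arm (snd z) v) \<partial>(lborel \<Otimes>\<^sub>M triangle_law \<epsilon>))"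

lemma sigma_finite_triangle_law: "\<epsilon> > 0 \<Longrightarrow> sigma_finite_measure (triangle_law \<epsilon>)"
  by (simp add: prob_space_triangle_law prob_space_imp_sigma_finite)

lemma integrable_arm:
  fixes f :: "real^'n \<Rightarrow> real"
  assumes \<epsilon>: "\<epsilon> > 0" and f: "integrable lborel f"
  shows "integrable (lborel \<Otimes>\<^sub>M triangle_law \<epsilon>) (\<lambda>z. f (fst z + arm (snd z) u))"
    and "(\<integral>z. f (fst z + arm (snd z) u) \<partial>(lborel \<Otimes>\<^sub>M triangle_law \<epsilon>)) = (\<integral>x. f x \<partial>lborel)"
proof -
  interpret L: prob_space "triangle_law \<epsilon> :: ((real^'n) \<times> (real^'n^'n)) measure"
    using \<epsilon> by (rule prob_space_triangle_law)
  have [measurable]: "f \<in> borel_measurable borel" using f by auto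
  show "integrable (lborel \<Otimes>\<^sub>M triangle_law \<epsilon>) (\<lambda>z. f (fst z + arm (snd z) u))"
    using integrable_shear[of "triangle_law \<epsilon>" "\<lambda>\<omega>. arm \<omega> u" "\<lambda>z. f (fst z)"]
      L.integrable_lborel_pair_fst(1)[OF f] L.sigma_finite_measure_axioms by simp
  show "(\<integral>z. f (fst z + arm (snd z) u) \<partial>(lborel \<Otimes>\<^sub>M triangle_law \<epsilon>)) = (\<integral>x. f x \<partial>lborel)"
    using integral_shear[of "triangle_law \<epsilon>" "\<lambda>\<omega>. arm \<omega> u" "\<lambda>z. f (fst z)"]
      L.integrable_lborel_pair_fst(2)[OF f] L.sigma_finite_measure_axioms by simp
qed

lemma integrable_bounded_mult:
  fixes f g :: "'b \<Rightarrow> real"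
  assumes "integrable M f" "g \<in> borel_measurable M" "\<And>x. \<bar>g x\<bar> \<le> B"
  shows "integrable M (\<lambda>x. f x * g x)" "integrable M (\<lambda>x. g x * f x)"
proof -
  show "integrable M (\<lambda>x. f x * g x)"
  proof (rule Bochner_Integration.integrable_bound)
    show "integrable M (\<lambda>x. B * f x)" using assms(1) by simp
    have "\<bar>f x * g x\<bar> \<le> \<bar>B * f x\<bar>" for x
    proof -
      have "\<bar>f x * g x\<bar> = \<bar>g x\<bar> * \<bar>f x\<bar>" by (simp add: abs_mult)
      also have "\<dots> \<le> \<bar>B\<bar> * \<bar>f x\<bar>" using assms(3)[of x] by (intro mult_right_mono) auto
      finally show ?thesis by (simp add: abs_mult)
    qed
    then show "AE x in M. norm (f x * g x) \<le> norm (B * f x)" by simp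
  qed (use assms in measurable)
  then show "integrable M (\<lambda>x. g x * f x)" by (simp add: mult.commute)
qed

definition bounded_density :: "real \<Rightarrow> ('a::euclidean_space \<Rightarrow> real) \<Rightarrow> bool" where
  "bounded_density K f \<longleftrightarrow> f \<in> borel_measurable borel \<and> (\<forall>x. 0 \<le> f x \<and> f x \<le> K)
     \<and> integrable lborel f \<and> (\<integral>x. f x \<partial>lborel) = 1"

lemma bounded_densityD:
  assumes "bounded_density K f"
  shows "f \<in> borel_measurable borel" "0 \<le> f x" "f x \<le> K" "integrable lborel f" "(\<integral>x. f x \<partial>lborel) = 1" "\<bar>f x\<bar> \<le> K"
  using assms by (simp_all add: bounded_density_def abs_of_nonneg)

abbreviation smoothed :: "real \<Rightarrow> ('a::euclidean_space \<Rightarrow> real) \<Rightarrow> 'a \<Rightarrow> real" where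
  "smoothed r f \<equiv> ball_average r (density lborel (\<lambda>x. ennreal (f x)))"

lemma bounded_density_smoothed:
  fixes f :: "'a::euclidean_space \<Rightarrow> real"
  assumes f: "bounded_density K f" and r: "r > 0"
  shows "bounded_density K (smoothed r f)"
proof -
  let ?\<nu> = "density lborel (\<lambda>x. ennreal (f x))"
  note [measurable] = bounded_densityD(1)[OF f]
  interpret prob_space ?\<nu>
    using f by (subst prob_space_density_iff) (auto simp: bounded_density_def)
  interpret U: prob_space "uniform_measure lborel (ball (0::'a) r)" using r by (rule prob_space_uniform_ball)
  have [measurable]: "smoothed r f \<in> borel_measurable borel"
    using r by (intro ball_average_borel finite_measure_axioms) auto
  have "prob_space (density lborel (\<lambda>x. ennreal (smoothed r f x)))"
    using r by (intro prob_space_ball_average prob_space_axioms) auto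
  then have "integrable lborel (smoothed r f) \<and> (\<integral>x. smoothed r f x \<partial>lborel) = 1"
    by (subst (asm) prob_space_density_iff) (auto simp: ball_average_nonneg)
  moreover have "smoothed r f x \<le> K" for x
    unfolding ball_average_density[OF r bounded_densityD(1)[OF f] bounded_densityD(2)[OF f]]
    using bounded_densityD(3,6)[OF f] by (intro U.integral_le_const U.integrable_const_bound[of _ K]) auto
  ultimately show ?thesis by (simp add: bounded_density_def ball_average_nonneg)
qed

text \<open>
  The heart of the proof. With the vertices \<open>x\<close> and \<open>x + arm \<omega> u\<close> fixed, the third vertex may be rotated
  about the line through them, since the law of \<open>\<omega>\<close> is invariant under rotations that fix \<open>u\<close>. So the
  last factor may be replaced by its mean \<open>M\<close> over \<open>N\<close> rotated positions \<open>w i\<close>, and the inequality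
  \<open>2 * p * q \<le> l * p^2 + q^2 / l\<close> leaves the mean square of \<open>M\<close> to be bounded, where \<open>a\<close> and \<open>b\<close> have
  disappeared. Of its \<open>N^2\<close> terms, the \<open>N\<close> diagonal ones are trivially bounded. In the others the base point
  is moved to the vertex at \<open>w i\<close>, and the remaining factor is evaluated at displacement \<open>arm \<omega> (w j - w i)\<close>
  from it. Since \<open>w i\<close> and \<open>w j\<close> differ, \<open>random_arm_smooths\<close> shows that its expectation is small.
\<close>

lemma triangle_form_smoothing_error:
  fixes u v :: "real^'n"
  assumes \<epsilon>: "\<epsilon> > 0" "\<epsilon> \<le> 1/2" and card: "CARD('n) \<ge> 3"
    and uv: "norm u = 1" "norm v = 1" "u \<bullet> v = 1/2"
    and a: "bounded_density K a" and b: "bounded_density K b" and g: "bounded_density K g"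
    and r: "r > 0" and N: "N > 0" and l: "l > 0"
  shows "\<bar>triangle_form \<epsilon> u v a b (\<lambda>x. smoothed r g x - g x)\<bar>
     \<le> (l * K^3 + 2 * K * (1 / real N + 64 * real CARD('n) * real N * r) / l) / 2"
proof -
  let ?L = "triangle_law \<epsilon> :: ((real^'n) \<times> (real^'n^'n)) measure"
  let ?Q = "lborel \<Otimes>\<^sub>M ?L"
  interpret L: prob_space ?L using \<epsilon>(1) by (rule prob_space_triangle_law)
  interpret Q: pair_sigma_finite lborel ?L
    by (simp add: pair_sigma_finite_def sigma_finite_lborel L.sigma_finite_measure_axioms)
  have K: "K \<ge> 0" using bounded_densityD(2,3)[OF a] order_trans by blast
  note sg = bounded_density_smoothed[OF g r]
  note [measurable] = bounded_densityD(1)[OF a] bounded_densityD(1)[OF b] bounded_densityD(1)[OF g] bounded_densityD(1)[OF sg]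
  define D where "D = (\<lambda>x. smoothed r g x - g x)"
  have [measurable]: "D \<in> borel_measurable borel" unfolding D_def by measurable
  have Dint: "integrable lborel D"
    unfolding D_def using bounded_densityD(4)[OF g] bounded_densityD(4)[OF sg] by simp
  have DK: "\<bar>D x\<bar> \<le> K" for x
    using bounded_densityD(2,3)[OF g, of x] bounded_densityD(2,3)[OF sg, of x] by (simp add: D_def abs_le_iff)
  have D1: "(\<integral>x. \<bar>D x\<bar> \<partial>lborel) \<le> 2"
  proof -
    have "(\<integral>x. \<bar>D x\<bar> \<partial>lborel) \<le> (\<integral>x. smoothed r g x + g x \<partial>lborel)"
      using Dint bounded_densityD(4)[OF g] bounded_densityD(4)[OF sg] bounded_densityD(2)[OF g] bounded_densityD(2)[OF sg]
      by (intro integral_mono) (auto simp: D_def abs_le_iff add_increasing add_increasing2)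
    then show ?thesis using bounded_densityD(4,5)[OF g] bounded_densityD(4,5)[OF sg] by simp
  qed
  obtain R :: "real \<Rightarrow> real^'n^'n" where R: "\<And>s. orthogonal_matrix (R s)" "\<And>s. R s *v u = u"
    "\<And>s t. \<lbrakk>0 \<le> s; s \<le> 1; 0 \<le> t; t \<le> 1\<rbrakk> \<Longrightarrow> \<bar>s - t\<bar> / 2 \<le> norm (R s *v v - R t *v v)"
    using rotations_about_axis[OF card uv] by blast
  \<comment> \<open>The parameters are spaced by 1 / N, so distinct positions are at least 1 / (2 N) apart.\<close>
  define w where "w i = R (real i / real N) *v v" for i
  have w: "1 / (2 * real N) \<le> norm (w i - w j)" if "i < N" "j < N" "i \<noteq> j" for i j
  proof -
    have "1 / real N \<le> \<bar>real i / real N - real j / real N\<bar>"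
      using that by (auto simp: diff_divide_distrib[symmetric] abs_divide divide_right_mono)
    then show ?thesis using R(3)[of "real i / real N" "real j / real N"] that by (simp add: w_def)
  qed
  define A where "A z = a (fst z)" for z :: "(real^'n) \<times> (real^'n) \<times> (real^'n^'n)"
  define B where "B z = b (fst z + arm (snd z) u)" for z
  define E where "E i z = D (fst z + arm (snd z) (w i))" for i z
  have [measurable]: "A \<in> borel_measurable ?Q" "B \<in> borel_measurable ?Q" "E i \<in> borel_measurable ?Q" for i
    unfolding A_def[abs_def] B_def[abs_def] E_def[abs_def] by measurable
  have Aint: "integrable ?Q A" and A1: "(\<integral>z. A z \<partial>?Q) = 1"
    unfolding A_def[abs_def] using L.integrable_lborel_pair_fst[OF bounded_densityD(4)[OF a]] bounded_densityD(5)[OF a] by auto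
  have A: "0 \<le> A z" "A z \<le> K" and B: "0 \<le> B z" "B z \<le> K" "\<bar>B z\<bar> \<le> K" and EK: "\<bar>E i z\<bar> \<le> K" for i z
    using bounded_densityD(2,3)[OF a] bounded_densityD(2,3,6)[OF b] DK by (auto simp: A_def B_def E_def)
  have Eint: "integrable ?Q (E i)" for i
    unfolding E_def using integrable_arm(1)[OF \<epsilon>(1) Dint] .
  have EEint: "integrable ?Q (\<lambda>z. E i z * E j z)" for i j
    using EK by (intro integrable_bounded_mult(1)[of _ _ _ K] Eint) auto
  have ABint: "integrable ?Q (\<lambda>z. A z * B z)"
    using B by (intro integrable_bounded_mult(1)[of _ _ _ K] Aint) auto
  have ABEint: "integrable ?Q (\<lambda>z. A z * B z * E i z)" for i
    using EK by (intro integrable_bounded_mult(1)[of _ _ _ K] ABint) auto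
  define T where "T = triangle_form \<epsilon> u v a b D"
  have rot: "(\<integral>z. A z * B z * E i z \<partial>?Q) = T" for i
  proof -
    have arm_rot: "arm (y, M ** S) x = arm (y, M) (S *v x)" for y :: "real^'n" and M S x
      by (simp add: arm_def matrix_vector_mul_assoc)
    have "T = (\<integral>z. a (fst z) * b (fst z + arm (snd z) u) * D (fst z + arm (snd z) v) \<partial>?Q)"
      by (simp add: T_def triangle_form_def)
    also have "\<dots> = (\<integral>z. A z * B z * E i z \<partial>?Q)"
      using triangle_law_rotation[OF \<epsilon>(1) R(1)[of "real i / real N"] sigma_finite_lborel,
          of "\<lambda>z. a (fst z) * b (fst z + arm (snd z) u) * D (fst z + arm (snd z) v)"]
      by (simp add: arm_rot R(2) A_def B_def E_def w_def)
    finally show ?thesis by simp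
  qed
  have diag: "\<bar>\<integral>z. E i z * E i z \<partial>?Q\<bar> \<le> 2 * K" for i
  proof -
    have "\<bar>\<integral>z. E i z * E i z \<partial>?Q\<bar> \<le> (\<integral>z. \<bar>E i z * E i z\<bar> \<partial>?Q)" by (rule integral_abs_bound)
    also have "\<dots> \<le> (\<integral>z. K * \<bar>E i z\<bar> \<partial>?Q)"
    proof (rule integral_mono)
      show "\<bar>E i z * E i z\<bar> \<le> K * \<bar>E i z\<bar>" for z
        unfolding abs_mult using EK by (rule mult_right_mono) simp
    qed (use EEint Eint in auto)
    also have "\<dots> = K * (\<integral>x. \<bar>D x\<bar> \<partial>lborel)"
      using integrable_arm(2)[OF \<epsilon>(1), of "\<lambda>x. \<bar>D x\<bar>"] Dint by (simp add: E_def)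
    also have "\<dots> \<le> K * 2" using D1 K by (rule mult_left_mono)
    finally show ?thesis by simp
  qed
  define C where "C = 64 * real CARD('n) * real N * r"
  have C: "C \<ge> 0" using r by (simp add: C_def)
  have off: "\<bar>\<integral>z. E i z * E j z \<partial>?Q\<bar> \<le> 2 * K * C" if ij: "i < N" "j < N" "i \<noteq> j" for i j
  proof -
    let ?w = "w j - w i"
    let ?F = "\<lambda>z. D (fst z) * D (fst z + arm (snd z) ?w)"
    have [measurable]: "?F \<in> borel_measurable ?Q" by measurable
    have Fint: "integrable ?Q ?F"
      using DK by (intro integrable_bounded_mult(1)[of _ _ _ K] L.integrable_lborel_pair_fst(1) Dint) auto
    have "(\<integral>z. E i z * E j z \<partial>?Q) = (\<integral>z. ?F z \<partial>?Q)"
      using integral_shear[of ?L "\<lambda>\<omega>. arm \<omega> (w i)" ?F] L.sigma_finite_measure_axioms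
      by (simp add: E_def arm_diff)
    also have "\<dots> = (\<integral>x. \<integral>\<omega>. ?F (x, \<omega>) \<partial>?L \<partial>lborel)"
      by (rule Q.integral_fst'[OF Fint, symmetric])
    also have "\<dots> = (\<integral>x. D x * (\<integral>\<omega>. D (x + arm \<omega> ?w) \<partial>?L) \<partial>lborel)" by simp
    also have "\<bar>\<dots>\<bar> \<le> (\<integral>x. \<bar>D x * (\<integral>\<omega>. D (x + arm \<omega> ?w) \<partial>?L)\<bar> \<partial>lborel)"
      by (rule integral_abs_bound)
    also have "\<dots> \<le> (\<integral>x. \<bar>D x\<bar> * (K * C) \<partial>lborel)"
    proof (rule integral_mono)
      show "integrable lborel (\<lambda>x. \<bar>D x * (\<integral>\<omega>. D (x + arm \<omega> ?w) \<partial>?L)\<bar>)"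
        using Q.integrable_fst'[OF Fint] by simp
      show "integrable lborel (\<lambda>x. \<bar>D x\<bar> * (K * C))" using Dint by simp
      fix x
      have nw: "1 / (2 * real N) \<le> norm ?w" using w[OF ij(2,1)] ij by simp
      then have w0: "norm ?w > 0" using N by (smt (verit) divide_pos_pos of_nat_0_less_iff)
      have "\<bar>\<integral>\<omega>. D (x + arm \<omega> ?w) \<partial>?L\<bar> \<le> K * (32 * real CARD('n) * r / norm ?w)"
        unfolding D_def using \<epsilon> r w0 bounded_densityD(1-3)[OF g] by (intro random_arm_smooths) auto
      also have "32 * real CARD('n) * r / norm ?w \<le> 32 * real CARD('n) * r / (1 / (2 * real N))"
        using nw w0 r N by (intro divide_left_mono) auto
      also have "\<dots> = C" by (simp add: C_def)
      finally have "\<bar>\<integral>\<omega>. D (x + arm \<omega> ?w) \<partial>?L\<bar> \<le> K * C" using K by (simp add: mult_left_mono)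
      then show "\<bar>D x * (\<integral>\<omega>. D (x + arm \<omega> ?w) \<partial>?L)\<bar> \<le> \<bar>D x\<bar> * (K * C)"
        by (simp add: abs_mult mult_left_mono)
    qed
    also have "\<dots> = (K * C) * (\<integral>x. \<bar>D x\<bar> \<partial>lborel)" by simp
    also have "\<dots> \<le> (K * C) * 2" using D1 K C by (intro mult_left_mono) auto
    finally show ?thesis by (simp add: mult_ac)
  qed
  define M where "M z = (\<Sum>i<N. E i z) / real N" for z
  have M2: "M z * M z = (\<Sum>i<N. \<Sum>j<N. E i z * E j z) / (real N)^2" for z
    by (simp add: M_def sum_product power2_eq_square)
  have MMint: "integrable ?Q (\<lambda>z. M z * M z)"
    unfolding M2 using EEint by (intro integrable_divide Bochner_Integration.integrable_sum)
  have "(\<integral>z. M z * M z \<partial>?Q) = (\<Sum>i<N. \<Sum>j<N. \<integral>z. E i z * E j z \<partial>?Q) / (real N)^2"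
    unfolding M2 using EEint by (simp add: Bochner_Integration.integral_sum Bochner_Integration.integrable_sum)
  also have "\<dots> \<le> (\<Sum>i<N. \<Sum>j<N. (if i = j then 2 * K else 0) + 2 * K * C) / (real N)^2"
  proof (intro divide_right_mono sum_mono)
    fix i j assume "i \<in> {..<N}" "j \<in> {..<N}"
    then show "(\<integral>z. E i z * E j z \<partial>?Q) \<le> (if i = j then 2 * K else 0) + 2 * K * C"
      using diag[of i] off[of i j] mult_nonneg_nonneg[OF K C] by (auto simp: abs_le_iff)
  qed simp
  also have "(\<Sum>i<N. \<Sum>j<N. (if i = j then 2 * K else 0) + 2 * K * C) = real N * (2 * K) + (real N)^2 * (2 * K * C)"
    by (simp add: sum.distrib power2_eq_square distrib_left mult.assoc)
  also have "\<dots> / (real N)^2 = 2 * K * (1 / real N + C)"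
    using N by (simp add: field_simps power2_eq_square)
  finally have MM: "(\<integral>z. M z * M z \<partial>?Q) \<le> 2 * K * (1 / real N + C)" .
  have TM: "T = (\<integral>z. A z * B z * M z \<partial>?Q)" and ABMint: "integrable ?Q (\<lambda>z. A z * B z * M z)"
  proof -
    have eq: "A z * B z * M z = (\<Sum>i<N. A z * B z * E i z) / real N" for z
      by (simp add: M_def sum_distrib_left)
    show "integrable ?Q (\<lambda>z. A z * B z * M z)"
      unfolding eq using ABEint by (intro integrable_divide Bochner_Integration.integrable_sum)
    show "T = (\<integral>z. A z * B z * M z \<partial>?Q)"
      unfolding eq using N ABEint by (simp add: Bochner_Integration.integral_sum rot)
  qed
  have "\<bar>T\<bar> \<le> (\<integral>z. \<bar>A z * B z * M z\<bar> \<partial>?Q)"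
    unfolding TM by (rule integral_abs_bound)
  also have "\<dots> \<le> (\<integral>z. (l * K^3 * A z + M z * M z / l) / 2 \<partial>?Q)"
  proof (rule integral_mono)
    show "integrable ?Q (\<lambda>z. \<bar>A z * B z * M z\<bar>)" using ABMint by simp
    show "integrable ?Q (\<lambda>z. (l * K^3 * A z + M z * M z / l) / 2)" using Aint MMint by simp
    fix z
    define p where "p = A z * B z" define q where "q = \<bar>M z\<bar>"
    have p: "p \<ge> 0" using A B by (simp add: p_def)
    \<comment> \<open>One factor of the probability density A is kept, since its integral is 1.\<close>
    have "p * p = A z * (A z * (B z * B z))" by (simp add: p_def mult_ac)
    also have "\<dots> \<le> A z * (K * (K * K))"
      using A B K by (intro mult_left_mono mult_mono) auto
    finally have pp: "p * p \<le> K^3 * A z" by (simp add: power3_eq_cube mult_ac)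
    \<comment> \<open>The inequality between the arithmetic and the geometric mean, weighted by l.\<close>
    have "0 \<le> (l * p - q)^2 / l" using l by simp
    also have "(l * p - q)^2 / l = l * (p * p) + q * q / l - 2 * (p * q)"
      using l by (simp add: power2_eq_square field_simps)
    finally have "2 * (p * q) \<le> l * (p * p) + q * q / l" by simp
    also have "\<dots> \<le> l * (K^3 * A z) + q * q / l" using pp l by simp
    finally have "2 * (p * q) \<le> l * K^3 * A z + M z * M z / l" by (simp add: q_def mult_ac)
    moreover have "\<bar>A z * B z * M z\<bar> = p * q" using A B by (simp add: p_def q_def abs_mult)
    ultimately show "\<bar>A z * B z * M z\<bar> \<le> (l * K^3 * A z + M z * M z / l) / 2" by simp
  qed
  also have "\<dots> = (l * K^3 + (\<integral>z. M z * M z \<partial>?Q) / l) / 2"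
    using Aint MMint A1 by simp
  also have "\<dots> \<le> (l * K^3 + 2 * K * (1 / real N + C) / l) / 2"
    using MM l by (simp add: divide_right_mono)
  finally show ?thesis by (simp add: T_def D_def C_def)
qed

section \<open>Coarsening one scale at a time\<close>

text \<open>
  The growth condition only at radii \<open>1 / 16 ^ i\<close>. The number \<open>q > 1\<close> measures how far the exponent
  is below the dimension: the bound says \<open>(1 + \<eta>) * r powr s\<close> with \<open>q = 16 powr (d - s)\<close>.
\<close>

definition frostman_16 :: "real \<Rightarrow> real \<Rightarrow> 'a::euclidean_space measure \<Rightarrow> bool" where
  "frostman_16 \<eta> q \<nu> \<longleftrightarrow>
     (\<forall>x i. measure \<nu> (ball x (1 / 16 ^ i)) \<le> (1 + \<eta>) * q ^ i * (1 / 16 ^ i) ^ DIM('a))"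

text \<open>
  What a density at scale \<open>1 / 16 ^ j\<close> obtained from a measure on the unit ball satisfies. The slack
  \<open>2 / 16 ^ j\<close> in the support dominates the sum of the radii \<open>1 / 16 ^ i\<close> over \<open>i \<ge> j\<close>, by which repeated
  averaging enlarges the support.
\<close>

definition tame :: "real \<Rightarrow> real \<Rightarrow> nat \<Rightarrow> ('a::euclidean_space \<Rightarrow> real) \<Rightarrow> bool" where
  "tame \<eta> q j f \<longleftrightarrow>
     bounded_density ((1 + \<eta>) * q ^ j / measure lborel (ball (0::'a) 1)) f \<and>
     (\<forall>x. f x \<noteq> 0 \<longrightarrow> norm x < 1 + 2 / 16 ^ j) \<and>
     frostman_16 \<eta> q (density lborel (\<lambda>x. ennreal (f x)))"

lemma ball_average_tame:
  fixes \<nu> :: "'a::euclidean_space measure"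
  assumes \<nu>: "prob_space \<nu>" and sets [measurable_cong, simp]: "sets \<nu> = sets borel"
    and frost: "frostman_16 \<eta> q \<nu>" and supp: "emeasure \<nu> (- cball 0 R) = 0" and R: "R + 1 / 16 ^ j \<le> 1 + 2 / 16 ^ j"
  shows "tame \<eta> q j (ball_average (1 / 16 ^ j) \<nu>)"
  unfolding tame_def
proof (intro conjI allI impI)
  interpret prob_space \<nu> by fact
  let ?r = "1 / 16 ^ j :: real" let ?f = "ball_average ?r \<nu>" let ?V = "measure lborel (ball (0::'a) 1)"
  let ?\<rho> = "density lborel (\<lambda>x. ennreal (?f x))"
  have r: "?r > 0" by simp
  have V: "?V > 0" by (rule measure_ball_pos) simp
  have [measurable]: "?f \<in> borel_measurable borel" using finite_measure_axioms sets r by (rule ball_average_borel)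
  interpret \<rho>: prob_space ?\<rho> using prob_space_ball_average[OF \<nu> sets r] .
  have "integrable lborel ?f \<and> (\<integral>x. ?f x \<partial>lborel) = 1"
    using prob_space_ball_average[OF \<nu> sets r] by (subst (asm) prob_space_density_iff) (auto simp: ball_average_nonneg)
  moreover have "?f x \<le> (1 + \<eta>) * q ^ j / ?V" for x
  proof -
    have "?f x \<le> (1 + \<eta>) * q ^ j * ?r ^ DIM('a) / (?r ^ DIM('a) * ?V)"
      unfolding ball_average_def measure_ball_scale[OF less_imp_le[OF r]]
      using frost V by (intro divide_right_mono) (auto simp: frostman_16_def)
    also have "\<dots> = (1 + \<eta>) * q ^ j / ?V" using r by (simp del: power_divide add: power_one_over)
    finally show ?thesis .
  qed
  ultimately show "bounded_density ((1 + \<eta>) * q ^ j / ?V) ?f"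
    by (simp add: bounded_density_def ball_average_nonneg)
  show "norm x < 1 + 2 / 16 ^ j" if "?f x \<noteq> 0" for x
  proof (rule ccontr)
    assume "\<not> norm x < 1 + 2 / 16 ^ j"
    then have "norm x \<ge> R + ?r" using R by simp
    have "ball x ?r \<subseteq> - cball 0 R"
    proof
      fix y assume "y \<in> ball x ?r"
      then show "y \<in> - cball 0 R"
        using \<open>norm x \<ge> R + ?r\<close> norm_triangle_ineq2[of x y] by (simp add: dist_norm)
    qed
    then have "emeasure \<nu> (ball x ?r) \<le> emeasure \<nu> (- cball 0 R)" by (intro emeasure_mono) auto
    with supp have "emeasure \<nu> (ball x ?r) = 0" by simp
    with that show False by (simp add: ball_average_def measure_def)
  qed
  interpret U: prob_space "uniform_measure lborel (ball (0::'a) ?r)" using r by (rule prob_space_uniform_ball)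
  show "frostman_16 \<eta> q ?\<rho>"
    unfolding frostman_16_def
  proof (intro allI)
    fix x i
    let ?b = "(1 + \<eta>) * q ^ i * (1 / 16 ^ i) ^ DIM('a)"
    have b: "measure \<nu> (ball y (1 / 16 ^ i)) \<le> ?b" for y using frost by (simp add: frostman_16_def)
    have b0: "?b \<ge> 0" using b[of 0] measure_nonneg order_trans by blast
    have "emeasure ?\<rho> (ball x (1 / 16 ^ i))
        = (\<integral>\<^sup>+u. emeasure \<nu> {y. y + u \<in> ball x (1 / 16 ^ i)} \<partial>uniform_measure lborel (ball 0 ?r))"
      by (rule emeasure_ball_average[OF finite_measure_axioms sets r]) simp
    also have "\<dots> \<le> (\<integral>\<^sup>+u. ennreal ?b \<partial>uniform_measure lborel (ball (0::'a) ?r))"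
    proof (rule nn_integral_mono)
      fix u :: 'a
      have "{y. y + u \<in> ball x (1 / 16 ^ i)} = ball (x - u) (1 / 16 ^ i)"
        by (auto simp: dist_norm algebra_simps)
      then show "emeasure \<nu> {y. y + u \<in> ball x (1 / 16 ^ i)} \<le> ennreal ?b"
        using b[of "x - u"] b0 by (simp add: emeasure_eq_measure)
    qed
    also have "\<dots> = ennreal ?b" using U.emeasure_space_1 by simp
    finally show "measure ?\<rho> (ball x (1 / 16 ^ i)) \<le> ?b"
      using b0 by (simp add: \<rho>.emeasure_eq_measure)
  qed
qed

lemma tame_smoothed:
  fixes f :: "'a::euclidean_space \<Rightarrow> real"
  assumes f: "tame \<eta> q (Suc j) f"
  shows "tame \<eta> q j (smoothed (1 / 16 ^ j) f)"
proof (rule ball_average_tame[where R = "1 + 2 / 16 ^ Suc j"])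
  have bd: "bounded_density ((1 + \<eta>) * q ^ Suc j / measure lborel (ball (0::'a) 1)) f"
    using f by (simp add: tame_def)
  note [measurable] = bounded_densityD(1)[OF bd]
  show "prob_space (density lborel (\<lambda>x. ennreal (f x)))"
    using bd by (subst prob_space_density_iff) (auto simp: bounded_density_def)
  show "frostman_16 \<eta> q (density lborel (\<lambda>x. ennreal (f x)))" using f by (simp add: tame_def)
  have f0: "f x = 0" if "norm x > 1 + 2 / 16 ^ Suc j" for x
    using f that by (force simp: tame_def)
  have "(\<integral>\<^sup>+x. ennreal (f x) * indicator (- cball 0 (1 + 2 / 16 ^ Suc j)) x \<partial>lborel) = (\<integral>\<^sup>+(x::'a). 0 \<partial>lborel)"
    by (rule nn_integral_cong) (auto simp: f0 not_le simp del: power_Suc split: split_indicator)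
  then show "emeasure (density lborel (\<lambda>x. ennreal (f x))) (- cball 0 (1 + 2 / 16 ^ Suc j)) = 0"
    by (subst emeasure_density) auto
  show "1 + 2 / 16 ^ Suc j + 1 / 16 ^ j \<le> 1 + 2 / (16 ^ j :: real)" by (simp add: field_simps)
qed simp

lemma bounded_density_mono: "bounded_density K f \<Longrightarrow> K \<le> K' \<Longrightarrow> bounded_density K' f"
  unfolding bounded_density_def by (meson order_trans)

lemma triangle_form_integrable:
  fixes f g h :: "real^'n \<Rightarrow> real"
  assumes \<epsilon>: "\<epsilon> > 0" and f: "integrable lborel f"
    and [measurable]: "g \<in> borel_measurable borel" "h \<in> borel_measurable borel"
    and g: "\<And>x. \<bar>g x\<bar> \<le> K" and h: "\<And>x. \<bar>h x\<bar> \<le> K'"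
  shows "integrable (lborel \<Otimes>\<^sub>M triangle_law \<epsilon>)
    (\<lambda>z. f (fst z) * g (fst z + arm (snd z) u) * h (fst z + arm (snd z) v))"
proof -
  interpret L: prob_space "triangle_law \<epsilon> :: ((real^'n) \<times> (real^'n^'n)) measure"
    using \<epsilon> by (rule prob_space_triangle_law)
  show ?thesis using g h f
    by (intro integrable_bounded_mult(1)[of _ _ _ K'] integrable_bounded_mult(1)[of _ _ _ K] L.integrable_lborel_pair_fst(1)) auto
qed

lemma triangle_form_swap: "triangle_form \<epsilon> u v f g h = triangle_form \<epsilon> v u f h g"
  by (simp add: triangle_form_def mult_ac)

text \<open>
  Take the vertex \<open>x + arm \<omega> u\<close> as the base point. The new edge vectors again have inner product
  \<open>1/2\<close> if \<open>u\<close> and \<open>v\<close> are unit vectors with \<open>u \<bullet> v = 1/2\<close>, so an estimate for the last argument of the form covers all three.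
\<close>

lemma triangle_form_rotate:
  fixes f g h :: "real^'n \<Rightarrow> real"
  assumes \<epsilon>: "\<epsilon> > 0" and [measurable]: "f \<in> borel_measurable borel" "g \<in> borel_measurable borel" "h \<in> borel_measurable borel"
  shows "triangle_form \<epsilon> u v f g h = triangle_form \<epsilon> (- u) (v - u) g f h"
  unfolding triangle_form_def
  by (subst integral_shear[of "triangle_law \<epsilon>" "\<lambda>\<omega>. arm \<omega> u"
        "\<lambda>z. g (fst z) * f (fst z + arm (snd z) (- u)) * h (fst z + arm (snd z) (v - u))", symmetric])
     (use \<epsilon> in \<open>auto simp: sigma_finite_triangle_law arm_minus arm_diff mult_ac\<close>)

lemma triangle_form_diff:
  fixes f g :: "real^'n \<Rightarrow> real"
  assumes \<epsilon>: "\<epsilon> > 0" and f: "bounded_density K f" and g: "bounded_density K g"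
  shows "triangle_form \<epsilon> u v g g g - triangle_form \<epsilon> u v f f f
     = triangle_form \<epsilon> (v - u) (- u) g g (\<lambda>x. g x - f x)
     + triangle_form \<epsilon> v u f g (\<lambda>x. g x - f x)
     + triangle_form \<epsilon> u v f f (\<lambda>x. g x - f x)"
proof -
  let ?d = "\<lambda>x. g x - f x" and ?Q = "lborel \<Otimes>\<^sub>M (triangle_law \<epsilon> :: ((real^'n) \<times> (real^'n^'n)) measure)"
  note [measurable] = bounded_densityD(1)[OF f] bounded_densityD(1)[OF g]
  note F = bounded_densityD(4,6)[OF f] and G = bounded_densityD(4,6)[OF g]
  have i1: "integrable ?Q (\<lambda>z. ?d (fst z) * g (fst z + arm (snd z) u) * g (fst z + arm (snd z) v))"
    using F G by (intro triangle_form_integrable[OF \<epsilon>, of _ _ _ K K]) auto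
  have i3: "integrable ?Q (\<lambda>z. f (fst z) * g (fst z + arm (snd z) u) * g (fst z + arm (snd z) v))"
    "integrable ?Q (\<lambda>z. f (fst z) * f (fst z + arm (snd z) u) * g (fst z + arm (snd z) v))"
    "integrable ?Q (\<lambda>z. f (fst z) * f (fst z + arm (snd z) u) * f (fst z + arm (snd z) v))"
    "integrable ?Q (\<lambda>z. g (fst z) * g (fst z + arm (snd z) u) * g (fst z + arm (snd z) v))"
    using F G by (auto intro!: triangle_form_integrable[OF \<epsilon>, of _ _ _ K K])
  \<comment> \<open>The difference is moved to the last argument in each term of the telescoping sum.\<close>
  have a: "triangle_form \<epsilon> (v - u) (- u) g g ?d = triangle_form \<epsilon> u v ?d g g"
    using triangle_form_rotate[OF \<epsilon>, of ?d g g u v] triangle_form_swap[of \<epsilon> "- u" "v - u" g ?d g] by simp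
  have "triangle_form \<epsilon> u v ?d g g = triangle_form \<epsilon> u v g g g - triangle_form \<epsilon> u v f g g"
    unfolding triangle_form_def using i3
    by (subst Bochner_Integration.integral_diff[symmetric]) (auto simp: algebra_simps)
  moreover have "triangle_form \<epsilon> v u f g ?d = triangle_form \<epsilon> u v f g g - triangle_form \<epsilon> u v f f g"
    unfolding triangle_form_swap[of \<epsilon> v u f g] unfolding triangle_form_def using i3
    by (subst Bochner_Integration.integral_diff[symmetric]) (auto simp: algebra_simps)
  moreover have "triangle_form \<epsilon> u v f f ?d = triangle_form \<epsilon> u v f f g - triangle_form \<epsilon> u v f f f"
    unfolding triangle_form_def using i3
    by (subst Bochner_Integration.integral_diff[symmetric]) (auto simp: algebra_simps)
  ultimately show ?thesis using a by simp
qed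

text \<open>
  The constant of \<open>triangle_form_coarsening\<close>. In the cubed factor, \<open>2 / measure lborel (ball 0 1)\<close>
  bounds the density at scale \<open>1\<close> (as \<open>1 + \<eta> \<le> 2\<close>), and the summand \<open>1\<close> makes the factor at least \<open>1\<close>.
\<close>

definition error_constant :: "'n::finite itself \<Rightarrow> real" where
  "error_constant _ = 9/4 * (2 / measure lborel (ball (0::real^'n) 1) + 1) ^ 3 * (3 + 128 * real CARD('n))"

text \<open>
  Passing from scale \<open>1 / 16 ^ Suc j\<close> to \<open>1 / 16 ^ j\<close> changes one argument of the form at a time. In
  \<open>triangle_form_smoothing_error\<close> the choice \<open>N = 4 ^ j\<close> balances \<open>1 / N\<close> against \<open>N * r\<close> for
  \<open>r = 1 / 16 ^ j\<close>, both being \<open>1 / 4 ^ j\<close>, and \<open>l = 1 / 2 ^ j\<close> then balances the two terms of the error.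
  The bound on the densities grows like \<open>q ^ j\<close>; its cube costs at most a multiple of \<open>(3/2) ^ j\<close>
  and leaves a multiple of \<open>(3/4) ^ j\<close>.
\<close>

lemma triangle_form_coarsening:
  fixes f :: "real^'n \<Rightarrow> real"
  assumes \<epsilon>: "\<epsilon> > 0" "\<epsilon> \<le> 1/2" and card: "CARD('n) \<ge> 3"
    and uv: "norm u = 1" "norm v = 1" "u \<bullet> v = 1/2"
    and q: "1 \<le> q" "q ^ 3 \<le> 3/2" and \<eta>: "0 \<le> \<eta>" "\<eta> \<le> 1" and f: "tame \<eta> q (Suc j) f"
  defines "g \<equiv> smoothed (1 / 16 ^ j) f"
  shows "triangle_form \<epsilon> u v g g g - triangle_form \<epsilon> u v f f f \<le> error_constant TYPE('n) * (3/4) ^ j"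
proof -
  let ?V = "measure lborel (ball (0::real^'n) 1)"
  have V: "?V > 0" by (rule measure_ball_pos) simp
  define c where "c = 2 / ?V + 1"
  define K where "K = c * q ^ Suc j"
  have c: "c \<ge> 1" using V by (simp add: c_def)
  have qj: "q ^ Suc j \<ge> 1" using q(1) by (rule one_le_power)
  have K: "K \<ge> 1" unfolding K_def using c qj mult_mono[of 1 c 1 "q ^ Suc j"] by simp
  have "(1 + \<eta>) * q ^ Suc j / ?V \<le> K"
  proof -
    have "(1 + \<eta>) / ?V \<le> c" using \<eta> V divide_right_mono[of "1+\<eta>" 2 ?V] by (simp add: c_def)
    then have "(1 + \<eta>) / ?V * q ^ Suc j \<le> c * q ^ Suc j" using qj by (intro mult_right_mono) auto
    then show ?thesis by (simp add: K_def)
  qed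
  then have F: "bounded_density K f" using f by (auto simp: tame_def intro: bounded_density_mono)
  then have G: "bounded_density K g" unfolding g_def by (rule bounded_density_smoothed) simp
  define e where "e = ((1/2) ^ j * K^3 + 2 * K * (1 / real (4 ^ j) + 64 * real CARD('n) * real (4 ^ j) * (1 / 16 ^ j)) / (1/2) ^ j) / 2"
  have e: "\<bar>triangle_form \<epsilon> u' v' a b (\<lambda>x. g x - f x)\<bar> \<le> e"
    if "norm u' = 1" "norm v' = 1" "u' \<bullet> v' = 1/2" "bounded_density K a" "bounded_density K b" for u' v' a b
    unfolding e_def g_def using that F by (intro triangle_form_smoothing_error[OF \<epsilon> card]) auto
  have uu: "u \<bullet> u = 1" and vv: "v \<bullet> v = 1" using uv by (simp_all add: norm_eq_1)
  have uv': "norm (v - u) = 1" "norm (- u) = 1" "(v - u) \<bullet> (- u) = 1/2" "v \<bullet> u = 1/2"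
    using uv uu vv by (simp_all add: norm_eq_1 inner_diff_left inner_diff_right inner_commute)
  have "triangle_form \<epsilon> u v g g g - triangle_form \<epsilon> u v f f f \<le> 3 * e"
    unfolding triangle_form_diff[OF \<epsilon>(1) F G]
    using e[OF uv'(1-3) G G] e[OF uv(2,1) uv'(4) F G] e[OF uv F F] by linarith
  also have "3 * e \<le> error_constant TYPE('n) * (3/4) ^ j"
  proof -
    have p4: "(4::real) ^ j = 2 ^ j * 2 ^ j" "(16::real) ^ j = 4 ^ j * 4 ^ j"
      by (simp_all add: power_mult_distrib[symmetric])
    have "e = (1/2) ^ j * (K ^ 3 + 2 * K * (1 + 64 * real CARD('n))) / 2"
      unfolding e_def by (simp add: p4 power_one_over field_simps)
    also have "\<dots> \<le> (1/2) ^ j * (K ^ 3 + 2 * K ^ 3 * (1 + 64 * real CARD('n))) / 2"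
      using K self_le_power[of K 3] by (intro divide_right_mono mult_left_mono add_left_mono mult_right_mono) auto
    also have "\<dots> = (1/2) ^ j * K ^ 3 * ((3 + 128 * real CARD('n)) / 2)" by (simp add: algebra_simps)
    also have "(1/2) ^ j * K ^ 3 \<le> c ^ 3 * (3/2) * (3/4) ^ j"
    proof -
      have "(1/2) ^ j * K ^ 3 = c ^ 3 * (q ^ 3 * ((1/2) * q ^ 3) ^ j)"
      proof -
        have "((1/2) * q ^ 3) ^ j = (1/2) ^ j * q ^ (3 * j)" by (simp only: power_mult_distrib power_mult)
        moreover have "K ^ 3 = c ^ 3 * (q ^ 3 * q ^ (3 * j))"
          by (simp only: K_def power_mult_distrib power_Suc power_mult[of q j 3, symmetric] mult.commute[of j 3])
        ultimately show ?thesis by (simp only: mult_ac)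
      qed
      also have "\<dots> \<le> c ^ 3 * ((3/2) * (3/4) ^ j)"
        using q c by (intro mult_left_mono mult_mono power_mono) auto
      finally show ?thesis by simp
    qed
    finally have "e \<le> c ^ 3 * (3/2) * (3/4) ^ j * ((3 + 128 * real CARD('n)) / 2)"
      by (simp add: mult_right_mono)
    then show ?thesis by (simp add: error_constant_def c_def[symmetric] mult_ac)
  qed
  finally show ?thesis .
qed

section \<open>Positivity of the triangle form\<close>

lemma AE_triangle_space:
  assumes \<epsilon>: "\<epsilon> > 0"
  shows "AE z in lborel \<Otimes>\<^sub>M (triangle_law \<epsilon> :: ((real^'n) \<times> (real^'n^'n)) measure).
    fst (snd z) \<in> side_ball \<and> snd (snd z) \<in> near_isometries \<epsilon>"
proof -
  let ?L = "triangle_law \<epsilon> :: ((real^'n) \<times> (real^'n^'n)) measure"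
  interpret Q: pair_sigma_finite lborel ?L
    using \<epsilon> by (simp add: pair_sigma_finite_def sigma_finite_lborel sigma_finite_triangle_law)
  have [measurable]: "(side_ball :: (real^'n) set) \<in> sets borel" by (simp add: side_ball_def)
  show ?thesis
  proof (rule Q.AE_pair_measure)
    show "AE x in lborel. AE \<omega> in ?L. fst (snd (x, \<omega>)) \<in> side_ball \<and> snd (snd (x, \<omega>)) \<in> near_isometries \<epsilon>"
      by (rule AE_I2) (use AE_triangle_law[OF \<epsilon>] in simp)
  qed measurable
qed

lemma norm_arm:
  assumes "fst \<omega> \<in> side_ball" "snd \<omega> \<in> near_isometries \<epsilon>" "norm w = 1" "\<epsilon> \<ge> 0"
  shows "\<bar>norm (arm \<omega> w) - norm (fst \<omega>)\<bar> \<le> \<epsilon>"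
proof -
  let ?t = "norm (fst \<omega>)"
  have t: "0 \<le> ?t" "?t \<le> 1" using side_ballD[OF assms(1)] by auto
  have "\<bar>norm (snd \<omega> *v w) - 1\<bar> \<le> \<epsilon>"
    using near_isometriesD[OF assms(2), of w] assms(3) by (simp add: abs_le_iff)
  then have "?t * \<bar>norm (snd \<omega> *v w) - 1\<bar> \<le> 1 * \<epsilon>" using t assms(4) by (intro mult_mono) auto
  moreover have "norm (arm \<omega> w) - ?t = ?t * (norm (snd \<omega> *v w) - 1)"
    by (simp add: arm_def right_diff_distrib)
  ultimately show ?thesis by (simp add: abs_mult)
qed

text \<open>
  A density with values in \<open>[0, K]\<close>, supported in the ball of radius \<open>R\<close>, differs from \<open>K\<close> on that ball by a
  function \<open>G \<ge> 0\<close> of integral \<open>K * W R - 1\<close>. If this is small, the density is nearly constant, and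
  each factor of the form may be replaced by \<open>K\<close> at a cost proportional to this integral. Base points in the
  ball of radius \<open>1/2\<close> keep all three vertices in the unit ball.
\<close>

lemma triangle_form_large_density:
  fixes f :: "real^'n \<Rightarrow> real"
  assumes \<epsilon>: "\<epsilon> > 0" "\<epsilon> \<le> 1/4" and uv: "norm u = 1" "norm v = 1"
    and f: "bounded_density K f" and supp: "\<And>x. f x \<noteq> 0 \<Longrightarrow> norm x < R" and R: "R \<ge> 1"
  defines "W \<equiv> \<lambda>\<rho>. measure lborel (ball (0::real^'n) \<rho>)"
  shows "triangle_form \<epsilon> u v f f f \<ge> K ^ 3 * W (1/2) - 3 * K\<^sup>2 * (K * W R - 1)"
proof -
  let ?L = "triangle_law \<epsilon> :: ((real^'n) \<times> (real^'n^'n)) measure"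
  let ?Q = "lborel \<Otimes>\<^sub>M ?L"
  interpret L: prob_space ?L using \<epsilon>(1) by (rule prob_space_triangle_law)
  note [measurable] = bounded_densityD(1)[OF f]
  have K: "K \<ge> 0" using bounded_densityD(2,3)[OF f] order_trans by blast
  define H :: "real^'n \<Rightarrow> real" where "H x = indicator (ball 0 (1/2)) x" for x
  define G where "G x = K * indicator (ball 0 R) x - f x" for x
  have Hint: "integrable lborel H" "(\<integral>x. H x \<partial>lborel) = W (1/2)"
    unfolding H_def[abs_def] W_def using emeasure_ball_less_top[of "0::real^'n" "1/2"] by (auto simp: less_top)
  have iB: "integrable lborel (\<lambda>x. K * indicator (ball (0::real^'n) R) x)"
    using emeasure_ball_less_top[of "0::real^'n" R] by (intro integrable_mult_right integrable_real_indicator) auto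
  have Gint: "integrable lborel G"
    unfolding G_def using iB bounded_densityD(4)[OF f] by (rule Bochner_Integration.integrable_diff)
  have GI: "(\<integral>x. G x \<partial>lborel) = K * W R - 1"
    unfolding G_def using iB bounded_densityD(4,5)[OF f] by (simp add: W_def)
  have [measurable]: "G \<in> borel_measurable borel" unfolding G_def by measurable
  have G0: "0 \<le> G x" for x
    using bounded_densityD(3)[OF f, of x] supp[of x] by (cases "f x = 0") (auto simp: G_def K split: split_indicator)
  have GK: "G x \<le> K" for x
    using bounded_densityD(2)[OF f, of x] K by (auto simp: G_def split: split_indicator)
  have Gf: "f x = K - G x" if "norm x < R" for x using that by (simp add: G_def)
  let ?rhs = "\<lambda>z. K ^ 3 * H (fst z) - K\<^sup>2 * (G (fst z) + G (fst z + arm (snd z) u) + G (fst z + arm (snd z) v))"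
  note ints = L.integrable_lborel_pair_fst[OF Hint(1)] L.integrable_lborel_pair_fst[OF Gint]
      integrable_arm[OF \<epsilon>(1) Gint, of u] integrable_arm[OF \<epsilon>(1) Gint, of v]
  have "K ^ 3 * W (1/2) - 3 * K\<^sup>2 * (K * W R - 1) = (\<integral>z. ?rhs z \<partial>?Q)"
    by (simp add: ints Hint GI)
  also have "\<dots> \<le> triangle_form \<epsilon> u v f f f"
    unfolding triangle_form_def
  proof (rule integral_mono_AE)
    show "integrable ?Q ?rhs" using ints by auto
    show "integrable ?Q (\<lambda>z. f (fst z) * f (fst z + arm (snd z) u) * f (fst z + arm (snd z) v))"
      using bounded_densityD(1,4,6)[OF f] by (intro triangle_form_integrable[OF \<epsilon>(1), of _ _ _ K K]) auto
    show "AE z in ?Q. ?rhs z \<le> f (fst z) * f (fst z + arm (snd z) u) * f (fst z + arm (snd z) v)"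
      using AE_triangle_space[OF \<epsilon>(1)]
    proof eventually_elim
      fix z :: "(real^'n) \<times> (real^'n) \<times> (real^'n^'n)"
      assume z: "fst (snd z) \<in> side_ball \<and> snd (snd z) \<in> near_isometries \<epsilon>"
      let ?a = "fst z" and ?b = "fst z + arm (snd z) u" and ?c = "fst z + arm (snd z) v"
      show "?rhs z \<le> f ?a * f ?b * f ?c"
      proof (cases "norm ?a < 1/2")
        case True
        have "norm (arm (snd z) w) \<le> 1/2" if "norm w = 1" for w
          using norm_arm[of "snd z" \<epsilon> w] z that \<epsilon> side_ballD(2)[of "fst (snd z)"] by (auto simp: abs_le_iff)
        then have "norm ?b < R" "norm ?c < R" "norm ?a < R"
          using True R uv norm_triangle_ineq[of ?a "arm (snd z) u"] norm_triangle_ineq[of ?a "arm (snd z) v"] by force+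
        then have eq: "f ?a * f ?b * f ?c = (K - G ?a) * (K - G ?b) * (K - G ?c)" by (simp add: Gf)
        have ineq: "K ^ 3 - K\<^sup>2 * (a + b + c) \<le> (K - a) * (K - b) * (K - c)"
          if "0 \<le> a" "a \<le> K" "0 \<le> b" "b \<le> K" "0 \<le> c" "c \<le> K" for a b c :: real
        proof -
          have "(K - a) * (K - b) * c \<le> K * K * c" using that by (intro mult_right_mono mult_mono) auto
          moreover have "0 \<le> K * (a * b)" using that by simp
          ultimately show ?thesis by (simp add: power2_eq_square power3_eq_cube algebra_simps)
        qed
        show ?thesis unfolding eq using True ineq[of "G ?a" "G ?b" "G ?c"] G0 GK by (simp add: H_def)
      next
        case False
        then have "?rhs z \<le> 0" using G0 by (simp add: H_def)
        also have "0 \<le> f ?a * f ?b * f ?c" using bounded_densityD(2)[OF f] by simp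
        finally show ?thesis .
      qed
    qed
  qed
  finally show ?thesis .
qed

text \<open>
  At a scale that is fixed in advance, a growth exponent close enough to the dimension leaves no room:
  the density is at most slightly more than \<open>1 / V\<close>, lives on a ball slightly larger than the unit ball, and
  has integral \<open>1\<close>.
\<close>

lemma triangle_form_pos_coarse_scale:
  fixes f :: "real^'n \<Rightarrow> real"
  assumes \<epsilon>: "\<epsilon> > 0" "\<epsilon> \<le> 1/4" and uv: "norm u = 1" "norm v = 1"
    and f: "tame \<eta> q j f" and q: "1 \<le> q" "q ^ j \<le> 1 + \<eta>" and \<eta>: "0 \<le> \<eta>"
    and small: "(1 + \<eta>)\<^sup>2 * (1 + 2 / 16 ^ j) ^ CARD('n) \<le> 1 + (1/2) ^ CARD('n) / 12"
  defines "V \<equiv> measure lborel (ball (0::real^'n) 1)"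
  shows "triangle_form \<epsilon> u v f f f \<ge> (1/2) ^ CARD('n) / (2 * V\<^sup>2)"
proof -
  have V: "V > 0" unfolding V_def by (rule measure_ball_pos) simp
  define c where "c = (1 + \<eta>) * q ^ j"
  define h where "h = (1/2::real) ^ CARD('n)"
  have h: "h > 0" by (simp add: h_def)
  have qj: "1 \<le> q ^ j" using q(1) by (rule one_le_power)
  have c1: "1 \<le> c" unfolding c_def using \<eta> qj mult_mono[of 1 "1 + \<eta>" 1 "q ^ j"] by simp
  have c2: "c \<le> (1 + \<eta>)\<^sup>2" unfolding c_def power2_eq_square using \<eta> q by (intro mult_left_mono) auto
  define \<kappa> where "\<kappa> = c * (1 + 2 / 16 ^ j) ^ CARD('n) - 1"
  have \<kappa>: "\<kappa> \<le> h / 12"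
    using small mult_right_mono[OF c2, of "(1 + 2 / 16 ^ j) ^ CARD('n)"] by (simp add: \<kappa>_def h_def)
  define K where "K = c / V"
  have "bounded_density K f" and supp: "\<And>x. f x \<noteq> 0 \<Longrightarrow> norm x < 1 + 2 / 16 ^ j"
    using f by (auto simp: tame_def K_def c_def V_def)
  then have "triangle_form \<epsilon> u v f f f \<ge> K ^ 3 * measure lborel (ball (0::real^'n) (1/2))
      - 3 * K\<^sup>2 * (K * measure lborel (ball (0::real^'n) (1 + 2 / 16 ^ j)) - 1)"
    using \<epsilon> uv by (intro triangle_form_large_density) auto
  also have "measure lborel (ball (0::real^'n) (1/2)) = h * V"
    using measure_ball_scale[of "1/2" "0::real^'n"] by (simp add: h_def V_def)
  also have "measure lborel (ball (0::real^'n) (1 + 2 / 16 ^ j)) = (1 + 2 / 16 ^ j) ^ CARD('n) * V"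
    using measure_ball_scale[of "1 + 2 / 16 ^ j" "0::real^'n"] by (simp add: V_def)
  also have "K * ((1 + 2 / 16 ^ j) ^ CARD('n) * V) - 1 = \<kappa>" using V by (simp add: K_def \<kappa>_def)
  also have "K ^ 3 * (h * V) - 3 * K\<^sup>2 * \<kappa> = K\<^sup>2 * (c * h - 3 * \<kappa>)"
    using V by (simp add: K_def power2_eq_square power3_eq_cube field_simps)
  finally have "K\<^sup>2 * (c * h - 3 * \<kappa>) \<le> triangle_form \<epsilon> u v f f f" .
  moreover have "(1 / V)\<^sup>2 * (h / 2) \<le> K\<^sup>2 * (c * h - 3 * \<kappa>)"
  proof (rule mult_mono)
    show "(1 / V)\<^sup>2 \<le> K\<^sup>2" unfolding K_def using c1 V by (intro power_mono divide_right_mono) auto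
    have "h \<le> c * h" using c1 h by simp
    then show "h / 2 \<le> c * h - 3 * \<kappa>" using \<kappa> h by linarith
  qed (use h in auto)
  ultimately show ?thesis by (simp add: h_def power_divide mult_ac)
qed

text \<open>
  By \<open>triangle_form_coarsening\<close>, coarsening the density from scale \<open>1 / 16 ^ j\<close> to scale \<open>1 / 16 ^ n\<close>
  raises the form by at most a geometric sum, which is smaller than the main term of \<open>triangle_form_pos_coarse_scale\<close>.
\<close>

lemma triangle_form_pos_all_scales:
  fixes f :: "real^'n \<Rightarrow> real"
  assumes \<epsilon>: "\<epsilon> > 0" "\<epsilon> \<le> 1/4" and card: "CARD('n) \<ge> 3"
    and uv: "norm u = 1" "norm v = 1" "u \<bullet> v = 1/2"
    and q: "1 \<le> q" "q ^ 3 \<le> 3/2" "q ^ n \<le> 1 + \<eta>" and \<eta>: "0 \<le> \<eta>" "\<eta> \<le> 1"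
    and small: "(1 + \<eta>)\<^sup>2 * (1 + 2 / 16 ^ n) ^ CARD('n) \<le> 1 + (1/2) ^ CARD('n) / 12"
      "4 * error_constant TYPE('n) * (3/4) ^ n < (1/2) ^ CARD('n) / (2 * (measure lborel (ball (0::real^'n) 1))\<^sup>2)"
    and j: "n \<le> j" and f: "tame \<eta> q j f"
  shows "triangle_form \<epsilon> u v f f f > 0"
proof -
  define C where "C = error_constant TYPE('n)"
  define m where "m = (1/2) ^ CARD('n) / (2 * (measure lborel (ball (0::real^'n) 1))\<^sup>2)"
  have C: "C \<ge> 0" unfolding C_def error_constant_def by (intro mult_nonneg_nonneg) auto
  \<comment> \<open>The subtracted term is the geometric sum of the errors at the scales from n to j - 1.\<close>
  have "m - 4 * C * ((3/4) ^ n - (3/4) ^ j) \<le> triangle_form \<epsilon> u v f f f"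
    using j f
  proof (induction j arbitrary: f rule: dec_induct)
    case base
    then show ?case
      using triangle_form_pos_coarse_scale[OF \<epsilon> uv(1,2) base q(1,3) \<eta>(1) small(1)] by (simp add: m_def)
  next
    case (step j)
    let ?g = "smoothed (1 / 16 ^ j) f"
    have "m - 4 * C * ((3/4) ^ n - (3/4) ^ j) \<le> triangle_form \<epsilon> u v ?g ?g ?g"
      by (intro step.IH tame_smoothed step.prems)
    moreover have "triangle_form \<epsilon> u v ?g ?g ?g - triangle_form \<epsilon> u v f f f \<le> C * (3/4) ^ j"
      unfolding C_def using \<epsilon> card uv q(1,2) \<eta> step.prems by (intro triangle_form_coarsening) auto
    ultimately show ?case by (simp add: algebra_simps)
  qed
  moreover have "4 * C * ((3/4) ^ n - (3/4) ^ j) \<le> 4 * C * (3/4) ^ n"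
    using C by (intro mult_left_mono) auto
  ultimately show ?thesis using small(2) by (simp add: C_def m_def)
qed

text \<open>
  The order of the choices matters: the scale \<open>n\<close> and the tolerance \<open>\<eta>\<close> come first and depend on the
  dimension only, and then \<open>q\<close> is taken so close to \<open>1\<close> that \<open>q ^ n\<close> is harmless.
\<close>

lemma exists_parameters:
  obtains n :: nat and \<eta> q :: real where "0 < \<eta>" "\<eta> \<le> 1" "1 < q" "q ^ 3 \<le> 3/2" "q ^ n \<le> 1 + \<eta>"
    "(1 + \<eta>)\<^sup>2 * (1 + 2 / 16 ^ n) ^ CARD('n::finite) \<le> 1 + (1/2) ^ CARD('n) / 12"
    "4 * error_constant TYPE('n) * (3/4) ^ n < (1/2) ^ CARD('n) / (2 * (measure lborel (ball (0::real^'n) 1))\<^sup>2)"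
proof -
  define h where "h = (1/2::real) ^ CARD('n)"
  have h: "h > 0" by (simp add: h_def)
  define m where "m = h / (2 * (measure lborel (ball (0::real^'n) 1))\<^sup>2)"
  have m: "m > 0" unfolding m_def using h measure_ball_pos[of 1 "0::real^'n"] by simp
  have p0: "(\<lambda>n. (a::real) ^ n) \<longlonglongrightarrow> 0" if "0 \<le> a" "a < 1" for a using that by (rule LIMSEQ_realpow_zero)
  have "(\<lambda>n. 2 * (1/16::real) ^ n) \<longlonglongrightarrow> 2 * 0" by (intro tendsto_intros p0) auto
  then have "(\<lambda>n. (1 + 1 / real (Suc n))\<^sup>2 * (1 + 2 * (1/16) ^ n) ^ CARD('n)) \<longlonglongrightarrow> (1 + 0)\<^sup>2 * (1 + 0) ^ CARD('n)"
    by (intro tendsto_intros LIMSEQ_Suc[OF lim_1_over_n]) simp_all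
  then have e1: "\<forall>\<^sub>F n in sequentially. (1 + 1 / real (Suc n))\<^sup>2 * (1 + 2 * (1/16) ^ n) ^ CARD('n) < 1 + h / 12"
    by (rule order_tendstoD) (use h in simp)
  have "(\<lambda>n. 4 * error_constant TYPE('n) * (3/4) ^ n) \<longlonglongrightarrow> 4 * error_constant TYPE('n) * 0"
    by (intro tendsto_intros p0) auto
  then have e2: "\<forall>\<^sub>F n in sequentially. 4 * error_constant TYPE('n) * (3/4) ^ n < m"
    by (rule order_tendstoD) (use m in simp)
  obtain n where n: "(1 + 1 / real (Suc n))\<^sup>2 * (1 + 2 * (1/16) ^ n) ^ CARD('n) < 1 + h / 12"
      "4 * error_constant TYPE('n) * (3/4) ^ n < m"
    using eventually_conj[OF e1 e2] unfolding eventually_sequentially by blast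
  define \<eta> where "\<eta> = 1 / real (Suc n)"
  have \<eta>: "0 < \<eta>" "\<eta> \<le> 1" by (auto simp: \<eta>_def)
  have ev: "\<forall>\<^sub>F q in at_right (1::real). q ^ k < a" if "1 < a" for k a
  proof (rule order_tendstoD(2))
    show "((\<lambda>q::real. q ^ k) \<longlongrightarrow> 1 ^ k) (at_right 1)" by (intro tendsto_intros)
  qed (use that in simp)
  have "\<forall>\<^sub>F q in at_right (1::real). q ^ 3 < 3/2" "\<forall>\<^sub>F q in at_right (1::real). q ^ n < 1 + \<eta>"
    by (rule ev, simp) (rule ev, use \<eta> in simp)
  moreover have "\<forall>\<^sub>F q in at_right (1::real). 1 < q" by (rule eventually_at_right_less)
  ultimately have "\<forall>\<^sub>F q in at_right (1::real). 1 < q \<and> q ^ 3 < 3/2 \<and> q ^ n < 1 + \<eta>"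
    by eventually_elim auto
  then obtain q where q: "1 < q" "q ^ 3 < 3/2" "q ^ n < 1 + \<eta>"
    using eventually_happens'[OF trivial_limit_at_right_real] by blast
  show thesis
    using that[of \<eta> q n] \<eta> q n by (simp add: \<eta>_def h_def m_def power_one_over)
qed

section \<open>From positivity to a triangle\<close>

lemma triangle_form_witness:
  fixes f :: "real^'n \<Rightarrow> real"
  assumes \<epsilon>: "\<epsilon> > 0" and uv: "norm u = 1" "norm v = 1" "norm (u - v) = 1"
    and pos: "triangle_form \<epsilon> u v f f f \<noteq> 0"
  obtains x y z t where "f x \<noteq> 0" "f y \<noteq> 0" "f z \<noteq> 0" "1/16 \<le> t"
    "\<bar>norm (x - y) - t\<bar> \<le> \<epsilon>" "\<bar>norm (y - z) - t\<bar> \<le> \<epsilon>" "\<bar>norm (x - z) - t\<bar> \<le> \<epsilon>"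
proof -
  let ?Q = "lborel \<Otimes>\<^sub>M (triangle_law \<epsilon> :: ((real^'n) \<times> (real^'n^'n)) measure)"
  let ?F = "\<lambda>z. f (fst z) * f (fst z + arm (snd z) u) * f (fst z + arm (snd z) v)"
  have "\<not> (AE z in ?Q. ?F z = 0)"
    using pos integral_eq_zero_AE[where f = "?F" and M = "?Q"] by (auto simp: triangle_form_def)
  moreover have "AE z in ?Q. ?F z = 0"
    if none: "\<And>z. \<lbrakk>fst (snd z) \<in> side_ball; snd (snd z) \<in> near_isometries \<epsilon>\<rbrakk> \<Longrightarrow> ?F z = 0"
    using AE_triangle_space[OF \<epsilon>] by eventually_elim (use none in blast)
  ultimately have "\<exists>z. fst (snd z) \<in> side_ball \<and> snd (snd z) \<in> near_isometries \<epsilon> \<and> ?F z \<noteq> 0" by blast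
  then obtain z where z: "fst (snd z) \<in> side_ball" "snd (snd z) \<in> near_isometries \<epsilon>" "?F z \<noteq> 0" by blast
  let ?a = "arm (snd z)" and ?t = "norm (fst (snd z))"
  have n: "\<bar>norm (?a w) - ?t\<bar> \<le> \<epsilon>" if "norm w = 1" for w
    using norm_arm[OF z(1,2) that] \<epsilon> by simp
  show thesis
  proof (rule that)
    show "f (fst z) \<noteq> 0" "f (fst z + ?a u) \<noteq> 0" "f (fst z + ?a v) \<noteq> 0" using z(3) by auto
    show "1/16 \<le> ?t" using side_ballD(1)[OF z(1)] .
    show "\<bar>norm (fst z - (fst z + ?a u)) - ?t\<bar> \<le> \<epsilon>" "\<bar>norm (fst z - (fst z + ?a v)) - ?t\<bar> \<le> \<epsilon>"
      using n[OF uv(1)] n[OF uv(2)] by simp_all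
    show "\<bar>norm (fst z + ?a u - (fst z + ?a v)) - ?t\<bar> \<le> \<epsilon>"
      using n[OF uv(3)] by (simp add: arm_diff)
  qed
qed

text \<open>
  The defect of being equilateral is continuous and attains its minimum on the compact set of triples whose
  first and last points are at distance at least \<open>c / 2\<close>.
\<close>

lemma almost_equilateral_imp_equilateral:
  fixes E :: "(real^'n) set"
  assumes E: "compact E"
    and approx: "\<And>\<delta>. \<delta> > 0 \<Longrightarrow> \<exists>x\<in>E. \<exists>y\<in>E. \<exists>z\<in>E. \<exists>t\<ge>c.
      \<bar>norm (x - y) - t\<bar> \<le> \<delta> \<and> \<bar>norm (y - z) - t\<bar> \<le> \<delta> \<and> \<bar>norm (x - z) - t\<bar> \<le> \<delta>"
    and c: "c > 0"
  shows "contains_equilateral_triangle E"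
proof -
  \<comment> \<open>Tolerances up to c / 2 keep the sides bounded away from 0.\<close>
  define T where "T = {p \<in> E \<times> E \<times> E. c / 2 \<le> norm (fst p - snd (snd p))}"
  define D where "D p = \<bar>norm (fst p - fst (snd p)) - norm (fst p - snd (snd p))\<bar>
      + \<bar>norm (fst (snd p) - snd (snd p)) - norm (fst p - snd (snd p))\<bar>" for p :: "(real^'n) \<times> (real^'n) \<times> (real^'n)"
  have "T = (E \<times> E \<times> E) \<inter> {p. c / 2 \<le> norm (fst p - snd (snd p))}" by (auto simp: T_def)
  moreover have "closed {p :: (real^'n) \<times> (real^'n) \<times> (real^'n). c / 2 \<le> norm (fst p - snd (snd p))}"
    by (intro closed_Collect_le continuous_intros)
  ultimately have T: "compact T" using E by (simp add: compact_Times compact_Int_closed)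
  have ex: "\<exists>p\<in>T. D p \<le> 4 * \<delta>" if \<delta>: "0 < \<delta>" "\<delta> \<le> c / 2" for \<delta>
  proof -
    obtain x y z t where p: "x \<in> E" "y \<in> E" "z \<in> E" "t \<ge> c"
      "\<bar>norm (x - y) - t\<bar> \<le> \<delta>" "\<bar>norm (y - z) - t\<bar> \<le> \<delta>" "\<bar>norm (x - z) - t\<bar> \<le> \<delta>"
      using approx[OF \<delta>(1)] by blast
    then have "(x, y, z) \<in> T" using \<delta> by (auto simp: T_def)
    moreover have "D (x, y, z) \<le> 4 * \<delta>" using p by (simp add: D_def)
    ultimately show ?thesis by blast
  qed
  have "T \<noteq> {}" using ex[of "c / 2"] c by auto
  moreover have "continuous_on T D" unfolding D_def by (intro continuous_intros)
  ultimately obtain p where p: "p \<in> T" "\<And>p'. p' \<in> T \<Longrightarrow> D p \<le> D p'"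
    using continuous_attains_inf[OF T] by blast
  have "D p \<le> 0"
  proof (rule ccontr)
    assume "\<not> D p \<le> 0"
    then have Dp: "D p > 0" by simp
    define \<delta> where "\<delta> = min (c / 2) (D p / 8)"
    have \<delta>: "0 < \<delta>" "\<delta> \<le> c / 2" "\<delta> \<le> D p / 8" using Dp c by (auto simp: \<delta>_def)
    obtain p' where "p' \<in> T" "D p' \<le> 4 * \<delta>" using ex[OF \<delta>(1,2)] by blast
    with p(2)[of p'] \<delta>(3) Dp show False by simp
  qed
  then have "norm (fst p - fst (snd p)) = norm (fst p - snd (snd p))"
    "norm (fst (snd p) - snd (snd p)) = norm (fst p - snd (snd p))" by (auto simp: D_def)
  moreover have "norm (fst p - snd (snd p)) > 0" "fst p \<in> E" "fst (snd p) \<in> E" "snd (snd p) \<in> E"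
    using p(1) c by (auto simp: T_def)
  ultimately show ?thesis unfolding contains_equilateral_triangle_def by metis
qed

text \<open>
  Points where a ball average of \<open>\<nu>\<close> is positive are close to \<open>E\<close>. Averaging at ever smaller scales
  gives, for every \<open>\<delta>\<close>, three points of \<open>E\<close> that form an equilateral triangle up to \<open>\<delta>\<close>.
\<close>

lemma equilateral_of_frostman_16:
  fixes \<nu> :: "(real^'n) measure" and E :: "(real^'n) set"
  assumes card: "CARD('n) \<ge> 3"
    and q: "1 \<le> q" "q ^ 3 \<le> 3/2" "q ^ n \<le> 1 + \<eta>" and \<eta>: "0 \<le> \<eta>" "\<eta> \<le> 1"
    and small: "(1 + \<eta>)\<^sup>2 * (1 + 2 / 16 ^ n) ^ CARD('n) \<le> 1 + (1/2) ^ CARD('n) / 12"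
      "4 * error_constant TYPE('n) * (3/4) ^ n < (1/2) ^ CARD('n) / (2 * (measure lborel (ball (0::real^'n) 1))\<^sup>2)"
    and E: "compact E" and \<nu>: "prob_space \<nu>" "sets \<nu> = sets borel" "emeasure \<nu> (- E) = 0"
    and unit: "emeasure \<nu> (- cball 0 1) = 0" and frost: "frostman_16 \<eta> q \<nu>"
  shows "contains_equilateral_triangle E"
proof (rule almost_equilateral_imp_equilateral[OF E, of "1/16"])
  interpret prob_space \<nu> by fact
  fix \<delta> :: real assume \<delta>: "\<delta> > 0"
  have "\<not> CARD('n) \<le> Suc 0" using card by simp
  then obtain a b :: 'n where ab: "a \<noteq> b" by (auto simp: card_le_Suc0_iff_eq)
  define u :: "real^'n" where "u = axis a 1"
  define v :: "real^'n" where "v = (1/2) *\<^sub>R axis a 1 + (sqrt 3 / 2) *\<^sub>R axis b 1"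
  have uv: "norm u = 1" "norm v = 1" "u \<bullet> v = 1/2" "norm (u - v) = 1"
    using ab by (simp_all add: u_def v_def norm_eq_1 inner_add_left inner_add_right inner_diff_left inner_diff_right inner_axis_axis)
  define \<epsilon> where "\<epsilon> = min (1/4) (\<delta>/2)"
  have \<epsilon>: "0 < \<epsilon>" "\<epsilon> \<le> 1/4" "\<epsilon> \<le> \<delta>/2" using \<delta> by (auto simp: \<epsilon>_def)
  have "\<forall>\<^sub>F j in sequentially. (1/16::real) ^ j < \<delta>/4"
    using LIMSEQ_realpow_zero[of "1/16"] \<delta> by (intro order_tendstoD(2)) auto
  then obtain j where j: "(1/16::real) ^ j < \<delta>/4" "n \<le> j"
    using eventually_conj[OF _ eventually_ge_at_top[of n]] eventually_happens'[OF sequentially_bot] by blast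
  let ?r = "1 / 16 ^ j :: real"
  have r: "2 * ?r \<le> \<delta>/2" using j(1) by (simp add: power_one_over)
  let ?f = "ball_average ?r \<nu>"
  have "tame \<eta> q j ?f"
    using \<nu> frost unit by (intro ball_average_tame[where R = 1]) (auto simp: field_simps)
  then have "triangle_form \<epsilon> u v ?f ?f ?f > 0"
    by (intro triangle_form_pos_all_scales[OF \<epsilon>(1,2) card uv(1-3) q \<eta> small j(2)])
  then obtain x y z t where xyz: "?f x \<noteq> 0" "?f y \<noteq> 0" "?f z \<noteq> 0" "1/16 \<le> t"
    "\<bar>norm (x - y) - t\<bar> \<le> \<epsilon>" "\<bar>norm (y - z) - t\<bar> \<le> \<epsilon>" "\<bar>norm (x - z) - t\<bar> \<le> \<epsilon>"
    using triangle_form_witness[OF \<epsilon>(1) uv(1,2,4), of ?f] by (metis less_irrefl)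
  have near: "\<exists>y\<in>E. norm (x - y) < ?r" if "?f x \<noteq> 0" for x
  proof (rule ccontr)
    assume "\<not> (\<exists>y\<in>E. norm (x - y) < ?r)"
    then have "ball x ?r \<subseteq> - E" by (auto simp: dist_norm)
    then have "emeasure \<nu> (ball x ?r) \<le> emeasure \<nu> (- E)"
      using compact_imp_closed[OF E] \<nu>(2) by (intro emeasure_mono) auto
    with \<nu>(3) that show False by (simp add: ball_average_def measure_def)
  qed
  obtain x' y' z' where E': "x' \<in> E" "y' \<in> E" "z' \<in> E"
    and n: "norm (x - x') < ?r" "norm (y - y') < ?r" "norm (z - z') < ?r"
    using near xyz(1-3) by metis
  have move: "\<bar>norm (a' - b') - t\<bar> \<le> \<delta>"
    if "norm (a - a') < ?r" "norm (b - b') < ?r" "\<bar>norm (a - b) - t\<bar> \<le> \<epsilon>" for a a' b b' :: "real^'n"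
  proof -
    have "\<bar>norm (a' - b') - norm (a - b)\<bar> \<le> norm ((a' - b') - (a - b))" by (rule norm_triangle_ineq3)
    also have "(a' - b') - (a - b) = (b - b') - (a - a')" by simp
    also have "norm \<dots> \<le> norm (b - b') + norm (a - a')" by (rule norm_triangle_ineq4)
    finally show ?thesis using that r \<epsilon>(3) by linarith
  qed
  show "\<exists>x\<in>E. \<exists>y\<in>E. \<exists>z\<in>E. \<exists>t\<ge>1/16.
      \<bar>norm (x - y) - t\<bar> \<le> \<delta> \<and> \<bar>norm (y - z) - t\<bar> \<le> \<delta> \<and> \<bar>norm (x - z) - t\<bar> \<le> \<delta>"
    using E' xyz(4) move[OF n(1,2) xyz(5)] move[OF n(2,3) xyz(6)] move[OF n(1,3) xyz(7)] by blast
qed simp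

section \<open>Rescaling to a nearly extremal ball\<close>

text \<open>
  Choose the ball so that \<open>measure \<mu> (ball a \<rho>) / \<rho> powr s\<close> is within a factor \<open>1 + \<eta>\<close> of the
  supremum of this quotient over all balls. The growth hypothesis makes the supremum finite; after
  rescaling the ball to the unit ball, its constant is replaced by \<open>1 + \<eta>\<close>. This also disposes of the
  diameter of the support.
\<close>

lemma exists_nearly_extremal_ball:
  fixes \<mu> :: "'a::euclidean_space measure"
  assumes \<mu>: "prob_space \<mu>" and sets: "sets \<mu> = sets borel" and \<eta>: "\<eta> > 0"
    and frost: "\<And>x r. r > 0 \<Longrightarrow> measure \<mu> (ball x r) \<le> c * r powr s"
  shows "\<exists>a \<rho>. \<rho> > 0 \<and> measure \<mu> (ball a \<rho>) > 0 \<and>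
    (\<forall>x r. r > 0 \<longrightarrow> measure \<mu> (ball x r) \<le> (1 + \<eta>) * measure \<mu> (ball a \<rho>) * (r / \<rho>) powr s)"
proof -
  interpret prob_space \<mu> by fact
  define X where "X = {measure \<mu> (ball x r) / r powr s | x r. r > 0}"
  have X: "measure \<mu> (ball x r) / r powr s \<in> X" if "r > 0" for x r using that by (auto simp: X_def)
  have bdd: "bdd_above X"
  proof (rule bdd_aboveI)
    fix y assume "y \<in> X"
    then show "y \<le> c" using frost by (auto simp: X_def divide_le_eq)
  qed
  have up: "measure \<mu> (ball x r) \<le> Sup X * r powr s" if "r > 0" for x r
    using cSup_upper[OF X[OF that] bdd] that by (simp add: divide_le_eq)
  have "\<exists>n. measure \<mu> (ball (0::'a) (real (Suc n))) \<noteq> 0"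
  proof (rule ccontr)
    assume "\<not> ?thesis"
    then have "emeasure \<mu> (\<Union>n. ball (0::'a) (real (Suc n))) = 0"
      using sets by (intro emeasure_UN_eq_0) (auto simp: emeasure_eq_measure)
    moreover have "(\<Union>n. ball (0::'a) (real (Suc n))) = UNIV"
    proof (intro set_eqI iffI UNIV_I)
      fix x :: 'a
      obtain n where "norm x < real n" using reals_Archimedean2 by blast
      then show "x \<in> (\<Union>n. ball (0::'a) (real (Suc n)))" by (intro UN_I[of n]) auto
    qed
    moreover have "space \<mu> = UNIV" using sets_eq_imp_space_eq[OF sets] by simp
    ultimately show False using emeasure_space_1 by simp
  qed
  then obtain n where "measure \<mu> (ball (0::'a) (real (Suc n))) > 0"
    by (metis measure_nonneg order_le_less)
  then have "0 < Sup X * real (Suc n) powr s" using up[of "real (Suc n)" 0] by simp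
  then have S: "Sup X > 0" by (simp add: zero_less_mult_iff)
  have "Sup X / (1 + \<eta>) < Sup X" using S \<eta> by (simp add: divide_less_eq)
  then obtain y where "y \<in> X" and y: "Sup X / (1 + \<eta>) < y" using less_cSupD[of X] X[of 1] by force
  then obtain a \<rho> where \<rho>: "\<rho> > 0" "y = measure \<mu> (ball a \<rho>) / \<rho> powr s" by (auto simp: X_def)
  have m: "measure \<mu> (ball a \<rho>) > 0"
  proof -
    have "0 < Sup X / (1 + \<eta>)" using S \<eta> by simp
    then have "0 < y" using y by simp
    then show ?thesis using \<rho> by (simp add: zero_less_divide_iff)
  qed
  show ?thesis
  proof (intro exI conjI allI impI, rule \<rho>(1), rule m)
    fix x r assume r: "(r::real) > 0"
    have "Sup X \<le> (1 + \<eta>) * (measure \<mu> (ball a \<rho>) / \<rho> powr s)" using y \<eta> \<rho>(2) by (simp add: field_simps)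
    then have "Sup X * r powr s \<le> (1 + \<eta>) * (measure \<mu> (ball a \<rho>) / \<rho> powr s) * r powr s" by (rule mult_right_mono) simp
    also have "\<dots> = (1 + \<eta>) * measure \<mu> (ball a \<rho>) * (r / \<rho>) powr s" using r \<rho> by (simp add: powr_divide)
    finally show "measure \<mu> (ball x r) \<le> (1 + \<eta>) * measure \<mu> (ball a \<rho>) * (r / \<rho>) powr s" using up[OF r, of x] by simp
  qed
qed

lemma equilateral_affine_image:
  fixes a :: "real^'n"
  assumes "contains_equilateral_triangle ((\<lambda>y. (y - a) /\<^sub>R \<rho>) ` E)" "\<rho> > 0"
  shows "contains_equilateral_triangle E"
proof -
  obtain x y z where E: "x \<in> E" "y \<in> E" "z \<in> E"
    and n: "norm ((x - a) /\<^sub>R \<rho> - (y - a) /\<^sub>R \<rho>) = norm ((y - a) /\<^sub>R \<rho> - (z - a) /\<^sub>R \<rho>)"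
      "norm ((y - a) /\<^sub>R \<rho> - (z - a) /\<^sub>R \<rho>) = norm ((x - a) /\<^sub>R \<rho> - (z - a) /\<^sub>R \<rho>)"
      "norm ((x - a) /\<^sub>R \<rho> - (z - a) /\<^sub>R \<rho>) > 0"
    using assms(1) unfolding contains_equilateral_triangle_def by blast
  have d: "norm ((p - a) /\<^sub>R \<rho> - (q - a) /\<^sub>R \<rho>) = norm (p - q) / \<rho>" for p q
  proof -
    have "(p - a) /\<^sub>R \<rho> - (q - a) /\<^sub>R \<rho> = (p - q) /\<^sub>R \<rho>" by (simp flip: scaleR_right_diff_distrib)
    then show ?thesis using assms(2) by (simp add: divide_inverse mult.commute)
  qed
  show ?thesis
    unfolding contains_equilateral_triangle_def
    using E n assms(2) unfolding d by (intro bexI[of _ x] bexI[of _ y] bexI[of _ z]) (auto simp: zero_less_divide_iff)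
qed

lemma blow_up_ball:
  fixes \<mu> :: "(real^'n) measure" and a :: "real^'n"
  assumes \<mu>: "prob_space \<mu>" and sets [measurable_cong]: "sets \<mu> = sets borel"
    and E: "closed E" "emeasure \<mu> (- E) = 0"
    and \<rho>: "\<rho> > 0" and m: "measure \<mu> (ball a \<rho>) > 0"
  defines "\<nu> \<equiv> distr (uniform_measure \<mu> (ball a \<rho>)) borel (\<lambda>y. (y - a) /\<^sub>R \<rho>)"
  shows "prob_space \<nu>" "sets \<nu> = sets borel" "emeasure \<nu> (- cball 0 1) = 0"
    "emeasure \<nu> (- ((\<lambda>y. (y - a) /\<^sub>R \<rho>) ` E)) = 0"
    "measure \<nu> (ball x r) \<le> measure \<mu> (ball (a + \<rho> *\<^sub>R x) (\<rho> * r)) / measure \<mu> (ball a \<rho>)"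
proof -
  interpret prob_space \<mu> by fact
  have sp: "space \<mu> = UNIV" using sets_eq_imp_space_eq[OF sets] by simp
  let ?B = "ball a \<rho>" and ?T = "\<lambda>y. (y - a) /\<^sub>R \<rho>"
  have B: "?B \<in> sets \<mu>" using sets by simp
  have m': "emeasure \<mu> ?B \<noteq> 0" "emeasure \<mu> ?B \<noteq> \<infinity>" using m by (auto simp: emeasure_eq_measure)
  interpret U: prob_space "uniform_measure \<mu> ?B" using m' by (rule prob_space_uniform_measure)
  have [measurable]: "?T \<in> measurable (uniform_measure \<mu> ?B) borel"
  proof -
    have "?T \<in> borel_measurable borel" by measurable
    then show ?thesis by (simp cong: measurable_cong_sets add: sets)
  qed
  have [measurable]: "?T \<in> borel_measurable borel" by measurable
  have em: "emeasure \<nu> A = emeasure \<mu> (?B \<inter> ?T -` A) / emeasure \<mu> ?B" if [measurable]: "A \<in> sets borel" for A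
  proof -
    have "?T -` A \<in> sets \<mu>"
      using measurable_sets[OF \<open>?T \<in> borel_measurable borel\<close> that] sets by simp
    then show ?thesis
      unfolding \<nu>_def using B that by (subst emeasure_distr) (auto simp: sp)
  qed
  show P: "prob_space \<nu>" unfolding \<nu>_def by (rule U.prob_space_distr) measurable
  interpret N: prob_space \<nu> by fact
  show "sets \<nu> = sets borel" by (simp add: \<nu>_def)
  have "?B \<inter> ?T -` (- cball 0 1) = {}"
  proof -
    have "norm (?T y) = norm (y - a) / \<rho>" for y using \<rho> by (simp add: divide_inverse mult.commute)
    moreover have "norm (y - a) / \<rho> < 1" if "y \<in> ?B" for y
      using that \<rho> by (simp add: dist_norm norm_minus_commute[of y])
    ultimately have "norm (?T y) < 1" if "y \<in> ?B" for y using that by metis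
    then show ?thesis by force
  qed
  then show "emeasure \<nu> (- cball 0 1) = 0" by (subst em) auto
  have "closed (?T ` E)"
  proof -
    have "?T = (\<lambda>y. y /\<^sub>R \<rho>) \<circ> (\<lambda>y. - a + y)" by (auto simp: algebra_simps)
    then have "?T ` E = (\<lambda>y. y /\<^sub>R \<rho>) ` ((\<lambda>y. - a + y) ` E)" by (simp add: image_comp)
    then show ?thesis by (simp only:) (intro closed_scaling closed_translation E(1))
  qed
  then have [measurable]: "?T ` E \<in> sets borel" by (rule borel_closed)
  have "?B \<inter> ?T -` (- (?T ` E)) \<subseteq> - E" by auto
  then have "emeasure \<mu> (?B \<inter> ?T -` (- (?T ` E))) \<le> emeasure \<mu> (- E)"
    using E(1) sets by (intro emeasure_mono) auto
  then show "emeasure \<nu> (- (?T ` E)) = 0" using E(2) by (subst em) auto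
  have sub: "?B \<inter> ?T -` (ball x r) \<subseteq> ball (a + \<rho> *\<^sub>R x) (\<rho> * r)"
  proof
    fix y assume "y \<in> ?B \<inter> ?T -` (ball x r)"
    then have "norm (x - ?T y) < r" by (simp add: dist_norm)
    moreover have "a + \<rho> *\<^sub>R x - y = \<rho> *\<^sub>R (x - ?T y)" using \<rho> by (simp add: algebra_simps)
    ultimately show "y \<in> ball (a + \<rho> *\<^sub>R x) (\<rho> * r)" using \<rho> by (simp add: dist_norm)
  qed
  have "emeasure \<nu> (ball x r) \<le> emeasure \<mu> (ball (a + \<rho> *\<^sub>R x) (\<rho> * r)) / emeasure \<mu> ?B"
    using sub sets by (subst em) (auto intro!: divide_right_mono_ennreal emeasure_mono)
  then show "measure \<nu> (ball x r) \<le> measure \<mu> (ball (a + \<rho> *\<^sub>R x) (\<rho> * r)) / measure \<mu> ?B"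
    using m by (simp add: emeasure_eq_measure N.emeasure_eq_measure divide_ennreal)
qed

text \<open>
  The dictionary between the exponent \<open>d - log 16 q\<close> and the parameter \<open>q\<close> of \<open>frostman_16\<close>.
\<close>

lemma powr_critical_exponent:
  assumes q: "q > 1"
  shows "(1 / 16 ^ i) powr (real d - log 16 q) = q ^ i * (1 / 16 ^ i) ^ d"
proof -
  have "(16 ^ i) powr log 16 q = (16 powr log 16 q) ^ i"
    by (simp add: powr_realpow[symmetric] powr_powr mult.commute)
  then have "(1 / 16 ^ i) powr log 16 q = 1 / q ^ i" using q by (simp add: powr_divide)
  then show ?thesis by (simp add: powr_diff powr_realpow)
qed

theorem theorem1p4:
  fixes c\<^sub>\<mu> :: real
  assumes "CARD('n::finite) \<ge> 4" and "c\<^sub>\<mu> > 0"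
  shows "\<exists>s\<^sub>0::real. s\<^sub>0 < real CARD('n) \<and>
    (\<forall>(E :: (real ^ 'n) set) (\<mu> :: (real ^ 'n) measure) (s::real).
       compact E \<longrightarrow>
       borel_prob_measure_supported_on \<mu> E \<longrightarrow>
       s > s\<^sub>0 \<longrightarrow>
       (\<forall>x r. r > 0 \<longrightarrow> measure \<mu> (ball x r) \<le> c\<^sub>\<mu> * r powr s) \<longrightarrow>
       contains_equilateral_triangle E)"
proof -
  obtain n :: nat and \<eta> q :: real where \<eta>: "0 < \<eta>" "\<eta> \<le> 1" and q: "1 < q" "q ^ 3 \<le> 3/2" "q ^ n \<le> 1 + \<eta>"
    and small: "(1 + \<eta>)\<^sup>2 * (1 + 2 / 16 ^ n) ^ CARD('n) \<le> 1 + (1/2) ^ CARD('n) / 12"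
      "4 * error_constant TYPE('n) * (3/4) ^ n < (1/2) ^ CARD('n) / (2 * (measure lborel (ball (0::real^'n) 1))\<^sup>2)"
    by (rule exists_parameters[where 'n = 'n])
  define s\<^sub>0 where "s\<^sub>0 = real CARD('n) - log 16 q"
  show ?thesis
  proof (intro exI[of _ s\<^sub>0] conjI allI impI)
    show "s\<^sub>0 < real CARD('n)" using q by (simp add: s\<^sub>0_def)
    fix E :: "(real ^ 'n) set" and \<mu> :: "(real ^ 'n) measure" and s :: real
    assume E: "compact E" and "borel_prob_measure_supported_on \<mu> E" and s: "s > s\<^sub>0"
      and frost: "\<forall>x r. r > 0 \<longrightarrow> measure \<mu> (ball x r) \<le> c\<^sub>\<mu> * r powr s"
    then have \<mu>: "prob_space \<mu>" "sets \<mu> = sets borel" "emeasure \<mu> (- E) = 0"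
      by (auto simp: borel_prob_measure_supported_on_def)
    have growth: "measure \<mu> (ball x r) \<le> c\<^sub>\<mu> * r powr s" if "r > 0" for x r
      using frost that by simp
    obtain a \<rho> where extremal: "\<rho> > 0 \<and> measure \<mu> (ball a \<rho>) > 0 \<and>
        (\<forall>x r. r > 0 \<longrightarrow> measure \<mu> (ball x r) \<le> (1 + \<eta>) * measure \<mu> (ball a \<rho>) * (r / \<rho>) powr s)"
      using exists_nearly_extremal_ball[OF \<mu>(1,2) \<eta>(1) growth] by blast
    then have \<rho>: "\<rho> > 0" and m: "measure \<mu> (ball a \<rho>) > 0" by simp_all
    have ext: "measure \<mu> (ball x r) \<le> (1 + \<eta>) * measure \<mu> (ball a \<rho>) * (r / \<rho>) powr s" if "r > 0" for x r
      using extremal that by simp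
    let ?T = "\<lambda>y. (y - a) /\<^sub>R \<rho>"
    define \<nu> where "\<nu> = distr (uniform_measure \<mu> (ball a \<rho>)) borel ?T"
    note \<nu> = blow_up_ball[OF \<mu>(1,2) compact_imp_closed[OF E] \<mu>(3) \<rho> m, folded \<nu>_def]
    have "frostman_16 \<eta> q \<nu>"
      unfolding frostman_16_def
    proof (intro allI)
      fix x i
      let ?r = "1 / 16 ^ i :: real"
      have "measure \<nu> (ball x ?r) \<le> measure \<mu> (ball (a + \<rho> *\<^sub>R x) (\<rho> * ?r)) / measure \<mu> (ball a \<rho>)" by (rule \<nu>(5))
      also have "\<dots> \<le> (1 + \<eta>) * ?r powr s"
        using ext[of "\<rho> * ?r" "a + \<rho> *\<^sub>R x"] \<rho> m by (simp add: divide_le_eq mult_ac)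
      also have "?r powr s \<le> ?r powr s\<^sub>0" using s by (intro powr_mono') auto
      also have "?r powr s\<^sub>0 = q ^ i * ?r ^ CARD('n)"
        unfolding s\<^sub>0_def using q(1) by (rule powr_critical_exponent)
      finally show "measure \<nu> (ball x ?r) \<le> (1 + \<eta>) * q ^ i * ?r ^ DIM(real^'n)"
        using \<eta> by (simp add: mult_left_mono mult.assoc)
    qed
    moreover have "compact (?T ` E)" using E by (intro compact_continuous_image continuous_intros)
    ultimately have "contains_equilateral_triangle (?T ` E)"
      using assms(1) q \<eta> \<nu>(1-4) by (intro equilateral_of_frostman_16[OF _ _ q(2,3) _ \<eta>(2) small]) auto
    then show "contains_equilateral_triangle E" using \<rho> by (rule equilateral_affine_image)
  qed
qed

end
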